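(* Let $d\ge 1$ and $M\in S_d^+$, and let $\mathcal T$ be an $M$-reduced mesh. Let $\Lambda$ be the Hopf–Lax operator associated with $M$ and $\mathcal T$ (defined in the context). Then the fixed point problem $$\delta(z)=\Lambda(\delta,z)\ \ (z\in\mathbb Z^d\setminus\{0\}),\qquad \delta(0)=0$$ has a unique solution $\delta_M:\mathbb Z^d\to\mathbb R_+$, which can be obtained in one pass by the fast marching algorithm. Moreover, writing $D_M(z):=\|z\|_M$, one has for all $z\in\mathbb Z^d$ $$0\le \delta_M(z)-D_M(z)\le d\, r_M(\mathcal T)\Big(1+\ln^+\Big(\frac{D_M(z)}{r_M(\mathcal T)}\Big)\Big),$$ where $\ln^+(r):=\max\{\ln r,0\}$. More precisely, if $-z\in\mathbb R_+T:=\{rx;\ r\ge 0,\ x\in T\}$ for some $T\in\mathcal T$, then $$0\le \delta_M(z)-D_M(z)\le d\,(\sin\theta_M(T))^2\, r_M(T)\Big(1+\ln^+\Big(\frac{D_M(z)}{r_M(T)}\Big)\Big).$$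
   Context: $S_d^+$ is the set of $d\times d$ symmetric positive definite matrices. For $M\in S_d^+$ and $u,v\in\mathbb R^d$, $\langle u,v\rangle_M:=u^{T}Mv$ and $\|u\|_M:=\sqrt{\langle u,u\rangle_M}$. An $M$-reduced mesh is a finite conforming mesh $\mathcal T$ of simplices in $\mathbb R^d$ such that: (I) the union of its simplices is a neighborhood of the origin; (II) the vertices of each $T\in\mathcal T$ lie in $\mathbb Z^d$ and $T$ has volume $1/d!$; (III) each $T\in\mathcal T$ has the origin as a vertex, and its other vertices $v_1,\dots,v_d$ satisfy $\langle v_i,v_j\rangle_M\ge 0$ for all $1\le i,j\le d$. For $\delta:\mathbb Z^d\to\mathbb R_+\cup\{\infty\}$ and $z\in\mathbb Z^d$, the Hopf–Lax operator is $$\Lambda(\delta,z):=\min\Big\{\Big\|\sum_{i=1}^k\alpha_iv_i\Big\|_M+\sum_{i=1}^k\alpha_i\,\delta(z+v_i)\Big\},$$ the minimum being over $1\le k\le d$, $\alpha_1,\dots,\alpha_k\ge0$ with $\sum_i\alpha_i=1$, and non-zero vertices $v_1,\dots,v_k$ of a common simplex $T\in\mathcal T$; with the convention $0\times\infty=0$. For $T\in\mathcal T$: $r_M(T):=\max_{z\in T}\|z\|_M$, $r_M(\mathcal T):=\max_{T\in\mathcal T}r_M(T)$, and $\theta_M(T)\in[0,\pi]$ is defined by $\cos\theta_M(T):=\min_{u,v\in T\setminus\{0\}}\frac{\langle u,v\rangle_M}{\|u\|_M\|v\|_M}$. The fast marching algorithm computes the solution in one pass, i.e. it fixes the values at the points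 of $\mathbb Z^d$ one at a time in order of increasing value, each point being finalized once. *)

theory Defs
  imports "HOL-Analysis.Analysis"
begin

definition lattice :: "(real^'n) set" where
  "lattice = {z. \<forall>i. z $ i \<in> \<int>}"

definition sym_pos_definite :: "real^'n^'n \<Rightarrow> bool" where
  "sym_pos_definite M \<longleftrightarrow> transpose M = M \<and> (\<forall>x. x \<noteq> 0 \<longrightarrow> x \<bullet> (M *v x) > 0)"

definition innerM :: "real^'n^'n \<Rightarrow> real^'n \<Rightarrow> real^'n \<Rightarrow> real" where
  "innerM M u v = u \<bullet> (M *v v)"

definition normM :: "real^'n^'n \<Rightarrow> real^'n \<Rightarrow> real" where
  "normM M u = sqrt (innerM M u u)"

text \<open>A simplex of the mesh is represented by its (finite) vertex set \<open>T\<close>;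
  the simplex itself is \<open>convex hull T\<close>.\<close>

definition M_reduced_mesh :: "real^'n^'n \<Rightarrow> (real^'n) set set \<Rightarrow> bool" where
  "M_reduced_mesh M \<T> \<longleftrightarrow>
     finite \<T> \<and>
     (\<forall>T\<in>\<T>. finite T \<and> card T = CARD('n) + 1 \<and> \<not> affine_dependent T) \<and>
     (\<forall>T1\<in>\<T>. \<forall>T2\<in>\<T>. convex hull T1 \<inter> convex hull T2 = convex hull (T1 \<inter> T2)) \<and>
     0 \<in> interior (\<Union>T\<in>\<T>. convex hull T) \<and>
     (\<forall>T\<in>\<T>. T \<subseteq> lattice \<and> measure lebesgue (convex hull T) = 1 / fact CARD('n)) \<and>
     (\<forall>T\<in>\<T>. 0 \<in> T \<and> (\<forall>u\<in>T. \<forall>v\<in>T. u \<noteq> 0 \<longrightarrow> v \<noteq> 0 \<longrightarrow> innerM M u v \<ge> 0))"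

text \<open>Hopf--Lax operator; \<open>\<delta>\<close> takes values in \<open>[0,\<infinity>]\<close> (ennreal, where \<open>0 * \<infinity> = 0\<close>).
  The minimum of the paper is written as an infimum (it is attained).\<close>

definition HopfLax :: "real^'n^'n \<Rightarrow> (real^'n) set set \<Rightarrow> (real^'n \<Rightarrow> ennreal) \<Rightarrow> real^'n \<Rightarrow> ennreal" where
  "HopfLax M \<T> \<delta> z = Inf {ennreal (normM M (\<Sum>i<k. \<alpha> i *\<^sub>R v i)) + (\<Sum>i<k. ennreal (\<alpha> i) * \<delta> (z + v i)) | k \<alpha> v.
       1 \<le> k \<and> k \<le> CARD('n) \<and> (\<forall>i<k. \<alpha> i \<ge> 0) \<and> (\<Sum>i<k. \<alpha> i) = 1 \<and>
       (\<exists>T\<in>\<T>. \<forall>i<k. v i \<in> T \<and> v i \<noteq> 0)}"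

definition rM_simplex :: "real^'n^'n \<Rightarrow> (real^'n) set \<Rightarrow> real" where
  "rM_simplex M T = Sup (normM M ` (convex hull T))"

definition rM_mesh :: "real^'n^'n \<Rightarrow> (real^'n) set set \<Rightarrow> real" where
  "rM_mesh M \<T> = Max (rM_simplex M ` \<T>)"

definition thetaM :: "real^'n^'n \<Rightarrow> (real^'n) set \<Rightarrow> real" where
  "thetaM M T = arccos (Inf {innerM M u v / (normM M u * normM M v) | u v.
       u \<in> convex hull T - {0} \<and> v \<in> convex hull T - {0}})"

definition lnplus :: "real \<Rightarrow> real" where
  "lnplus r = max (ln r) 0"

definition restrict_inf :: "(real^'n \<Rightarrow> real) \<Rightarrow> (real^'n) set \<Rightarrow> real^'n \<Rightarrow> ennreal" where
  "restrict_inf \<delta> A z = (if z \<in> A then ennreal (\<delta> z) else top)"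

definition is_solution :: "real^'n^'n \<Rightarrow> (real^'n) set set \<Rightarrow> (real^'n \<Rightarrow> real) \<Rightarrow> bool" where
  "is_solution M \<T> \<delta> \<longleftrightarrow> (\<forall>z\<in>lattice. \<delta> z \<ge> 0) \<and> \<delta> 0 = 0 \<and>
     (\<forall>z\<in>lattice - {0}. ennreal (\<delta> z) = HopfLax M \<T> (\<lambda>y. ennreal (\<delta> y)) z)"

text \<open>One pass of fast marching: an enumeration \<open>f\<close> of \<open>\<int>^d\<close>, starting at 0, where
  each newly accepted point minimises the tentative value computed from the previously
  accepted points only, and this tentative value is its final value.\<close>

definition fast_marching_one_pass :: "real^'n^'n \<Rightarrow> (real^'n) set set \<Rightarrow> (real^'n \<Rightarrow> real) \<Rightarrow> bool" where
  "fast_marching_one_pass M \<T> \<delta> \<longleftrightarrow> (\<exists>f :: nat \<Rightarrow> real^'n.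
     bij_betw f UNIV lattice \<and> f 0 = 0 \<and>
     (\<forall>n\<ge>1. ennreal (\<delta> (f n)) = HopfLax M \<T> (restrict_inf \<delta> (f ` {..<n})) (f n) \<and>
        (\<forall>z \<in> lattice - f ` {..<n}.
           HopfLax M \<T> (restrict_inf \<delta> (f ` {..<n})) (f n) \<le> HopfLax M \<T> (restrict_inf \<delta> (f ` {..<n})) z)))"

end

(* The acute simplices make the update causal: if a vertex of positive weight had a value at least
   the updated one, deleting it and renormalizing the weights would lower the objective. Sublevel
   sets of a solution are finite, so minimality arguments give a comparison principle, hence
   uniqueness, the lower bound by the norm, and the one-pass property for an enumeration by
   increasing value. Existence comes from the greatest fixed point of the monotone operator on
   [0,infinity]-valued functions, whose finiteness is part of the error estimate.

   For the error estimate, unimodularity writes -z as a sum of n_v copies of the vertices v of a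
   simplex. Using the weights n_v / N with N the sum of the n_v, the excess over the norm is, by
   induction on N, at most sin^2(theta) times the sum of |v| H(n_v), with H the harmonic numbers;
   finally H(n) <= 1 + ln n and n_v |v| <= |z|. *)

theory Submission
  imports Defs
begin

section \<open>Real inequalities and enumerations\<close>

text \<open>Put x = -z and let a step delete one copy of v, leaving y = x - v. With the weights n_v
  / N the update direction is parallel to x and costs |x| / N, which is exactly the average drop of
  the linear form <., x> / |x| under the deletion. If the value at -y were this linear form at y,
  the update would return |x| with no error. The error of a step is therefore the gap |y| - <y, x> /
  |x|, which is quadratic in the component of y orthogonal to x. That component is the opposite of
  the one of v, so it stays short however long y is, and since angles in the simplex are at most
  theta it brings in sin^2(theta). As y still contains n_v - 1 copies of v, the gap is at most
  sin^2(theta) |v| / n_v.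

  Finiteness of the greatest fixed point has to be known before the comparison with solutions can be
  used. The estimate is therefore proved for extended-valued W with W <= Lambda(W) away from the
  origin, and is applied a second time to the solution.\<close>

lemma harm_le_ln: "1 \<le> n \<Longrightarrow> harm n \<le> 1 + ln (real n)"
proof (induction n rule: dec_induct)
  case base
  show ?case by (simp add: harm_def)
next
  case (step n)
  have "ln (real n / real (Suc n)) \<le> real n / real (Suc n) - 1"
    using step by (intro ln_le_minus_one) auto
  also have "\<dots> = - inverse (real (Suc n))" by (simp add: field_simps)
  finally show ?case using step by (simp add: harm_Suc ln_div)
qed

text \<open>The derivative of t * (1 + ln (D / t)) in t is ln (D / t), so this function increases up
  to its peak value D at t = D. For r below D the claim is this monotonicity; for r above D the peak
  is already at most r. It is used to replace the length of each vertex by a common radius.\<close>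

lemma lnplus_scaled_mono:
  assumes "0 < a" "a \<le> r" "a \<le> D"
  shows "a * (1 + ln (D / a)) \<le> r * (1 + lnplus (D / r))"
proof (cases "D \<le> r")
  case True
  have "ln (D / a) \<le> D / a - 1" using assms by (intro ln_le_minus_one) auto
  then have "a * (1 + ln (D / a)) \<le> a * (D / a)" using assms by (intro mult_left_mono) auto
  also have "\<dots> \<le> r * 1" using True assms by simp
  also have "\<dots> \<le> r * (1 + lnplus (D / r))" using assms by (intro mult_left_mono) (auto simp: lnplus_def)
  finally show ?thesis .
next
  case False
  have "ln (r / a) \<le> r / a - 1" using assms by (intro ln_le_minus_one) auto
  then have "a * ln (r / a) \<le> a * (r / a - 1)" using assms by (intro mult_left_mono) auto
  also have "\<dots> = r - a" using assms by (simp add: field_simps)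
  finally have 1: "a * ln (r / a) \<le> r - a" .
  have 2: "a * ln (D / r) \<le> r * ln (D / r)" using False assms by (intro mult_right_mono) auto
  have "ln (D / a) = ln (D / r) + ln (r / a)" using assms False by (simp add: ln_div)
  then have "a * (1 + ln (D / a)) \<le> r * (1 + ln (D / r))" using 1 2 by (simp add: algebra_simps)
  also have "\<dots> \<le> r * (1 + lnplus (D / r))" using assms by (intro mult_left_mono) (auto simp: lnplus_def)
  finally show ?thesis .
qed

text \<open>The scalars stand for \<open>X = \<parallel>v + y\<parallel>\<close>, \<open>Y = \<parallel>y\<parallel>\<close>, \<open>V = \<parallel>v\<parallel>\<close> and \<open>g = \<langle>y, v\<rangle>\<close>, where \<open>v\<close> has multiplicity
  \<open>n\<close> in \<open>v + y\<close>. The squared component \<open>q\<close> of \<open>y\<close> orthogonal to \<open>v + y\<close> is that of \<open>v\<close>, so it is at most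
  \<open>(1 - c\<^sup>2)\<close> times the smaller of \<open>Y\<^sup>2\<close> and \<open>V\<^sup>2\<close>.\<close>

lemma cone_step_estimate:
  fixes X Y V g c :: real and n :: nat
  assumes "0 < X" "0 \<le> Y" "0 < V" "0 \<le> c" "c \<le> 1" "1 \<le> n"
    and sq: "X\<^sup>2 = Y\<^sup>2 + 2 * g + V\<^sup>2"
    and g: "(real n - 1) * V\<^sup>2 \<le> g" "g \<le> Y * V"
    and v: "c * X * V \<le> g + V\<^sup>2" and y: "c * X * Y \<le> Y\<^sup>2 + g"
  shows "real n * (Y - (Y\<^sup>2 + g) / X) \<le> (1 - c\<^sup>2) * V"
proof (cases "Y = 0")
  case True
  then have "g \<le> 0" using g(2) by simp
  moreover have "0 \<le> (real n - 1) * V\<^sup>2" using assms by simp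
  ultimately have "g = 0" using g(1) by linarith
  then show ?thesis using assms True by (simp add: power_le_one)
next
  case False
  define p q where "p = (Y\<^sup>2 + g) / X" and "q = Y\<^sup>2 - p\<^sup>2"
  define s where "s = 1 - c\<^sup>2"
  have Y: "0 < Y" using False \<open>0 \<le> Y\<close> by simp
  have s: "0 \<le> s" using assms by (simp add: s_def power_le_one)
  have "0 \<le> (real n - 1) * V\<^sup>2" using assms by simp
  then have g0: "0 \<le> g" using g(1) by linarith
  have pX: "p * X = Y\<^sup>2 + g" using \<open>0 < X\<close> by (simp add: p_def)
  have "0 \<le> p" using g0 \<open>0 < X\<close> by (simp add: p_def)
  have cp: "c * Y \<le> p" using y \<open>0 < X\<close> by (simp add: p_def field_simps)
  have "(c * Y)\<^sup>2 \<le> p\<^sup>2" using cp assms by (intro power_mono) auto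
  then have q1: "q \<le> s * Y\<^sup>2" by (simp add: q_def s_def power_mult_distrib algebra_simps)
  define w where "w = (g + V\<^sup>2) / X"
  have wX: "w * X = g + V\<^sup>2" using \<open>0 < X\<close> by (simp add: w_def)
  \<comment> \<open>With x = v + y, both ends of this chain are the Gram determinant of y and v,
    written once with the pair x, y and once with the pair x, v. Here \<open>p\<close> and
    \<open>w\<close> are the coordinates of y and v along x.\<close>
  have "X\<^sup>2 * (Y\<^sup>2 - p\<^sup>2) = X\<^sup>2 * Y\<^sup>2 - (p * X)\<^sup>2"
    by (simp add: power_mult_distrib algebra_simps)
  also have "\<dots> = X\<^sup>2 * V\<^sup>2 - (w * X)\<^sup>2"
    unfolding pX wX sq by (simp add: power2_eq_square algebra_simps)
  also have "\<dots> = X\<^sup>2 * (V\<^sup>2 - w\<^sup>2)"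
    by (simp add: power_mult_distrib algebra_simps)
  finally have "X\<^sup>2 * (Y\<^sup>2 - p\<^sup>2) = X\<^sup>2 * (V\<^sup>2 - w\<^sup>2)" .
  then have qw: "q = V\<^sup>2 - w\<^sup>2" using \<open>0 < X\<close> by (simp add: q_def)
  have "c * V \<le> w" using v \<open>0 < X\<close> by (simp add: w_def field_simps)
  then have "(c * V)\<^sup>2 \<le> w\<^sup>2" using assms by (intro power_mono) auto
  then have q2: "q \<le> s * V\<^sup>2" by (simp add: qw s_def power_mult_distrib algebra_simps)
  have Yp: "(Y - p) * (Y + p) = q" by (simp add: q_def power2_eq_square algebra_simps)
  have pos: "0 < Y + p" using Y \<open>0 \<le> p\<close> by simp
  \<comment> \<open>Since Y - p = q / (Y + p), this is the claim. For n = 1 the two bounds on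
    \<open>q\<close> give q <= s * Y * V. For n >= 2 the vector y still contains a copy of v, so
    that (n - 1) * V <= Y and V <= p, and q <= s * V^2 suffices.\<close>
  have "real n * q \<le> s * V * (Y + p)"
  proof (cases "n = 1")
    case True
    have "q \<le> s * (Y * V)"
    proof (cases "Y \<le> V")
      case True
      then have "Y\<^sup>2 \<le> Y * V" using Y by (simp add: power2_eq_square)
      then show ?thesis using q1 s by (meson mult_left_mono order_trans)
    next
      case False
      then have "V\<^sup>2 \<le> Y * V" using \<open>0 < V\<close> by (simp add: power2_eq_square)
      then show ?thesis using q2 s by (meson mult_left_mono order_trans)
    qed
    also have "\<dots> \<le> s * V * (Y + p)"
      using s \<open>0 < V\<close> \<open>0 \<le> p\<close> by (simp add: algebra_simps)
    finally show ?thesis using True by simp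
  next
    case False
    have "(real n - 1) * V * V \<le> Y * V" using g by (simp add: power2_eq_square)
    then have nV: "(real n - 1) * V \<le> Y" using \<open>0 < V\<close> by simp
    have "1 * V \<le> (real n - 1) * V" using False \<open>1 \<le> n\<close> \<open>0 < V\<close> by (intro mult_right_mono) auto
    then have VY: "V \<le> Y" using nV by simp
    have "1 * V\<^sup>2 \<le> (real n - 1) * V\<^sup>2" using False \<open>1 \<le> n\<close> by (intro mult_right_mono) auto
    then have Vg: "V\<^sup>2 \<le> g" using g(1) by simp
    have VY2: "V\<^sup>2 \<le> Y\<^sup>2" using VY \<open>0 < V\<close> by (simp add: power_mono)
    have "(V * X)\<^sup>2 \<le> (Y\<^sup>2 + g)\<^sup>2"
    proof -
      have eq: "(Y\<^sup>2 + g)\<^sup>2 - (V * X)\<^sup>2 = Y\<^sup>2 * (Y\<^sup>2 - V\<^sup>2) + 2 * g * (Y\<^sup>2 - V\<^sup>2) + (g - V\<^sup>2) * (g + V\<^sup>2)"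
        unfolding power_mult_distrib sq by (simp add: power2_eq_square algebra_simps)
      have "0 \<le> (Y\<^sup>2 + g)\<^sup>2 - (V * X)\<^sup>2" unfolding eq using VY2 Vg g0 by (intro add_nonneg_nonneg mult_nonneg_nonneg) auto
      then show ?thesis by (simp only: diff_ge_0_iff_ge)
    qed
    then have "V * X \<le> Y\<^sup>2 + g" by (rule power2_le_imp_le) (simp add: g0)
    then have "V \<le> p" using \<open>0 < X\<close> by (simp add: p_def field_simps)
    then have "real n * V \<le> Y + p" using nV by (simp add: algebra_simps)
    then have "s * V * (real n * V) \<le> s * V * (Y + p)" using s \<open>0 < V\<close> by (intro mult_left_mono) auto
    moreover have "real n * q \<le> real n * (s * V\<^sup>2)" using q2 by (intro mult_left_mono) auto
    ultimately show ?thesis by (simp add: power2_eq_square algebra_simps)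
  qed
  then have "real n * (Y - p) * (Y + p) \<le> s * V * (Y + p)" using Yp by (simp add: mult.assoc)
  then show ?thesis using pos by (simp add: p_def s_def)
qed

text \<open>Greedy choice of a minimizer among the remaining points, which exists because sublevel
  sets are finite. No point x is missed: otherwise all chosen values would be at most g x, and an
  injective sequence would stay in a finite sublevel set.\<close>

lemma ex_increasing_enumeration:
  fixes g :: "'a \<Rightarrow> real"
  assumes "infinite S" and fin: "\<And>c. finite {x \<in> S. g x \<le> c}"
    and a: "a \<in> S" "\<And>x. x \<in> S \<Longrightarrow> g a \<le> g x"
  shows "\<exists>f :: nat \<Rightarrow> 'a. bij_betw f UNIV S \<and> f 0 = a \<and>
    (\<forall>n. \<forall>x\<in>S - f ` {..<n}. g (f n) \<le> g x)"
proof -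
  have ex: "\<exists>x\<in>S - A. \<forall>y\<in>S - A. g x \<le> g y" if "finite A" for A
  proof -
    have "infinite (S - A)" using \<open>infinite S\<close> that by simp
    then obtain x0 where x0: "x0 \<in> S - A" using infinite_imp_nonempty by blast
    define B where "B = {x \<in> S - A. g x \<le> g x0}"
    have "finite B" unfolding B_def using fin[of "g x0"] by (rule rev_finite_subset) auto
    moreover have "x0 \<in> B" using x0 by (simp add: B_def)
    ultimately have "\<exists>x. is_arg_min g (\<lambda>x. x \<in> B) x" by (intro ex_is_arg_min_if_finite) auto
    then obtain x where x: "x \<in> B" "\<And>y. y \<in> B \<Longrightarrow> g x \<le> g y"
      by (auto simp: is_arg_min_linorder)
    show ?thesis
    proof (intro bexI ballI)
      show "x \<in> S - A" using x(1) by (simp add: B_def)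
      fix y assume y: "y \<in> S - A"
      show "g x \<le> g y"
      proof (cases "g y \<le> g x0")
        case True
        then show ?thesis using x(2) y by (simp add: B_def)
      next
        case False
        then show ?thesis using x(1) by (simp add: B_def)
      qed
    qed
  qed
  \<comment> \<open>The first choice is fixed to be \<open>a\<close>, since \<open>a\<close> may
    share the minimal value with other points.\<close>
  define pick where "pick A = (if A = {} then a else SOME x. x \<in> S - A \<and> (\<forall>y\<in>S - A. g x \<le> g y))" for A
  have pick: "pick A \<in> S - A" "\<And>y. y \<in> S - A \<Longrightarrow> g (pick A) \<le> g y" if "finite A" for A
  proof -
    have "pick A \<in> S - A \<and> (\<forall>y\<in>S - A. g (pick A) \<le> g y)"
    proof (cases "A = {}")
      case True
      then show ?thesis using a by (simp add: pick_def)
    next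
      case False
      have "\<exists>x. x \<in> S - A \<and> (\<forall>y\<in>S - A. g x \<le> g y)" using ex[OF that] by blast
      from someI_ex[OF this] show ?thesis unfolding pick_def if_not_P[OF False] .
    qed
    then show "pick A \<in> S - A" "\<And>y. y \<in> S - A \<Longrightarrow> g (pick A) \<le> g y" by auto
  qed
  define acc where "acc n = ((\<lambda>A. insert (pick A) A) ^^ n) {}" for n
  define f where "f n = pick (acc n)" for n
  have acc: "acc n = f ` {..<n}" for n
    by (induction n) (auto simp: acc_def f_def lessThan_Suc)
  have f: "f n \<in> S - f ` {..<n}" "\<And>y. y \<in> S - f ` {..<n} \<Longrightarrow> g (f n) \<le> g y" for n
    using pick[of "acc n"] by (auto simp: f_def[of n] acc)
  have inj: "inj f"
  proof (rule linorder_inj_onI)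
    fix m n :: nat assume "m < n"
    then have "f m \<in> f ` {..<n}" by simp
    then show "f m \<noteq> f n" using f(1)[of n] by auto
  qed linarith
  have "S \<subseteq> range f"
  proof (rule ccontr)
    assume "\<not> S \<subseteq> range f"
    then obtain x where "x \<in> S" "x \<notin> range f" by auto
    then have "range f \<subseteq> {y \<in> S. g y \<le> g x}" using f by blast
    then have "finite (range f)" using fin finite_subset by blast
    then show False using inj finite_imageD by blast
  qed
  moreover have "range f \<subseteq> S" using f(1) by blast
  ultimately have "bij_betw f UNIV S" using inj unfolding bij_betw_def by blast
  moreover have "f 0 = a" by (simp add: f_def acc_def pick_def)
  ultimately show ?thesis using f(2) by blast
qed

section \<open>Unimodular simplices\<close>

text \<open>The determinant formula for volumes is only available for well-ordered index types; this copy
  of an arbitrary finite index type carries such an order.\<close>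

typedef (overloaded) ('n :: finite) ordered_index = "{..<CARD('n)}"
  by (rule exI[of _ 0]) simp

instantiation ordered_index :: (finite) linorder
begin

definition less_eq_ordered_index :: "'a ordered_index \<Rightarrow> 'a ordered_index \<Rightarrow> bool" where
  "less_eq_ordered_index i j \<longleftrightarrow> Rep_ordered_index i \<le> Rep_ordered_index j"

definition less_ordered_index :: "'a ordered_index \<Rightarrow> 'a ordered_index \<Rightarrow> bool" where
  "less_ordered_index i j \<longleftrightarrow> Rep_ordered_index i < Rep_ordered_index j"

instance
  by standard (auto simp: less_eq_ordered_index_def less_ordered_index_def Rep_ordered_index_inject)

end

instance ordered_index :: (finite) finite
proof
  have "inj (Rep_ordered_index :: 'a ordered_index \<Rightarrow> nat)"
    by (simp add: inj_on_def Rep_ordered_index_inject)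
  moreover have "finite (range (Rep_ordered_index :: 'a ordered_index \<Rightarrow> nat))"
    by (simp add: type_definition.Rep_range[OF type_definition_ordered_index])
  ultimately show "finite (UNIV :: 'a ordered_index set)" using finite_imageD by blast
qed

instance ordered_index :: (finite) wellorder
proof (rule wf_wellorderI)
  have "{(i, j). i < (j :: 'a ordered_index)} = inv_image less_than Rep_ordered_index"
    by (auto simp: less_ordered_index_def)
  then show "wf {(i, j). i < (j :: 'a ordered_index)}" by simp
qed intro_classes

lemma card_ordered_index: "CARD('n::finite ordered_index) = CARD('n)"
proof -
  have "CARD('n ordered_index) = card (range (Rep_ordered_index :: 'n ordered_index \<Rightarrow> nat))"
    by (intro card_image[symmetric]) (simp add: inj_on_def Rep_ordered_index_inject)
  then show ?thesis by (simp add: type_definition.Rep_range[OF type_definition_ordered_index])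
qed

lemma prod_Basis_cart: "(\<Prod>b\<in>Basis. x \<bullet> b) = (\<Prod>i\<in>UNIV. x $ i)" for x :: "real^'n"
proof -
  have "Basis = range (\<lambda>i :: 'n. axis i (1 :: real))" by (auto simp: Basis_vec_def)
  moreover have "inj (\<lambda>i :: 'n. axis i (1 :: real))" by (simp add: inj_on_def axis_eq_axis)
  ultimately show ?thesis
    using prod.reindex[of "\<lambda>i :: 'n. axis i (1 :: real)" UNIV "\<lambda>b. x \<bullet> b"]
    by (simp add: inner_axis)
qed

text \<open>Renaming coordinates sends boxes to boxes with the same side lengths, and Lebesgue
  measure is determined by its values on boxes. This carries the volume of a simplex over to the
  ordered index type.\<close>

lemma measure_lebesgue_reindex:
  fixes h :: "'m::finite \<Rightarrow> 'n::finite" and S :: "(real^'n) set"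
  assumes h: "bij h" and "compact S"
  shows "measure lebesgue ((\<lambda>x. \<chi> j. x $ h j) ` S) = measure lebesgue S"
proof -
  define R :: "real^'n \<Rightarrow> real^'m" where "R x = (\<chi> j. x $ h j)" for x
  define R' :: "real^'m \<Rightarrow> real^'n" where "R' y = (\<chi> i. y $ inv h i)" for y
  have lin: "linear R" "linear R'" by (auto simp: R_def R'_def linear_iff vec_eq_iff)
  have R'R: "R' (R x) = x" for x
    using h by (simp add: R_def R'_def vec_eq_iff bij_is_surj surj_f_inv_f)
  have RR': "R (R' y) = y" for y
    using h by (simp add: R_def R'_def vec_eq_iff bij_is_inj)
  have cont: "continuous_on A R" "continuous_on B R'" for A B
    using lin by (simp_all add: linear_continuous_on linear_linear)
  have [measurable]: "R' \<in> borel \<rightarrow>\<^sub>M borel"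
    using cont(2) by (rule borel_measurable_continuous_onI)
  have distr: "lborel = distr lborel borel R'"
  proof (rule lborel_eqI)
    fix l u :: "real^'n" assume le: "\<And>b. b \<in> Basis \<Longrightarrow> l \<bullet> b \<le> u \<bullet> b"
    have le': "l $ i \<le> u $ i" for i using le[of "axis i 1"] by (simp add: inner_axis axis_in_Basis_iff)
    have "R' -` box l u = box (R l) (R u)"
    proof (intro set_eqI iffI)
      fix y assume "y \<in> R' -` box l u"
      then have "l $ h j < R' y $ h j \<and> R' y $ h j < u $ h j" for j by (simp add: mem_box_cart)
      then show "y \<in> box (R l) (R u)"
        using h by (simp add: mem_box_cart R_def R'_def bij_is_inj)
    next
      fix y assume "y \<in> box (R l) (R u)"
      then have "R l $ inv h i < y $ inv h i \<and> y $ inv h i < R u $ inv h i" for i by (simp add: mem_box_cart)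
      then show "y \<in> R' -` box l u"
        using h by (simp add: mem_box_cart R_def R'_def bij_is_surj surj_f_inv_f)
    qed
    moreover have "(\<Prod>b\<in>Basis. (R u - R l) \<bullet> b) = (\<Prod>b\<in>Basis. (u - l) \<bullet> b)"
      unfolding prod_Basis_cart using prod.reindex_bij_betw[OF h, of "\<lambda>i. u $ i - l $ i"] by (simp add: R_def)
    moreover have "R l \<bullet> b \<le> R u \<bullet> b" if "b \<in> Basis" for b
      using le' that by (auto simp: Basis_vec_def inner_axis R_def)
    ultimately show "emeasure (distr lborel borel R') (box l u) = (\<Prod>b\<in>Basis. (u - l) \<bullet> b)"
      by (simp add: emeasure_distr)
  qed simp
  have "compact (R ` S)" using \<open>compact S\<close> cont by (intro compact_continuous_image)
  then have RS: "measure lebesgue (R ` S) = measure lborel (R ` S)"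
    by (intro measure_completion) (auto dest: compact_imp_closed)
  have img: "R ` S = R' -` S" using R'R RR' by (auto simp: image_iff) metis
  have "measure lebesgue (R ` S) = measure lborel (R' -` S)" using RS by (simp add: img)
  also have "\<dots> = measure (distr lborel borel R') S"
    using \<open>compact S\<close> by (subst measure_distr) (auto dest: compact_imp_closed)
  also have "\<dots> = measure lebesgue S"
    unfolding distr[symmetric] using \<open>compact S\<close>
    by (intro measure_completion[symmetric]) (auto dest: compact_imp_closed)
  finally show ?thesis by (simp add: R_def[abs_def])
qed

lemma det_Ints:
  fixes A :: "real^'n^'n"
  assumes "\<And>i j. A $ i $ j \<in> \<int>"
  shows "det A \<in> \<int>"
  unfolding det_def using assms by (intro Ints_sum Ints_mult Ints_prod) auto

text \<open>The volume condition says that the integer matrix with columns \<open>e j\<close> has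
  determinant 1 or -1. By Cramer's rule each coordinate is then, up to sign, the determinant of an
  integer matrix.\<close>

lemma unimodular_coordinates_Ints_aux:
  fixes e :: "'n::{finite,wellorder} \<Rightarrow> real^('n::_)" and c :: "'n \<Rightarrow> real"
  assumes inj: "inj e" and nz: "0 \<notin> range e"
    and Ints: "\<And>i j. e j $ i \<in> \<int>" "\<And>i. (\<Sum>j\<in>UNIV. c j *\<^sub>R e j) $ i \<in> \<int>"
    and vol: "measure lebesgue (convex hull (insert 0 (range e))) = 1 / fact CARD('n)"
  shows "c k \<in> \<int>"
proof -
  define A where "A = (\<chi> i j. e j $ i)"
  define x where "x = (\<Sum>j\<in>UNIV. c j *\<^sub>R e j)"
  have "measure lebesgue (convex hull (insert 0 (range e))) = measure lborel (convex hull (insert 0 (range e)))"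
    by (intro measure_completion) (simp add: borel_compact finite_imp_compact_convex_hull)
  also have "\<dots> = \<bar>det (\<chi> i j. e j $ i - 0 $ i)\<bar> / fact CARD('n)"
  proof (rule content_simplex)
    show "card (insert 0 (range e)) = Suc CARD('n)"
      using nz inj by (simp add: card_image)
    show "bij_betw e UNIV (insert 0 (range e) - {0})"
      using nz inj by (simp add: bij_betw_def)
  qed auto
  finally have det: "\<bar>det A\<bar> = 1" using vol by (simp add: A_def)
  have "A *v (\<chi> j. c j) = x"
    by (simp add: A_def x_def vec_eq_iff matrix_vector_mult_def mult.commute)
  then have "(\<chi> j. c j) = (\<chi> k. det (\<chi> i j. if j = k then x $ i else A $ i $ j) / det A)"
    using det cramer[of A] by auto
  then have "c k = det (\<chi> i j. if j = k then x $ i else A $ i $ j) / det A"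
    by (simp add: vec_eq_iff)
  moreover have "det (\<chi> i j. if j = k then x $ i else A $ i $ j) \<in> \<int>"
    using Ints by (intro det_Ints) (simp add: A_def x_def)
  moreover have "det A = 1 \<or> det A = -1" using det by linarith
  ultimately show ?thesis by auto
qed

text \<open>The coordinate renaming \<open>R\<close> is linear and injective and preserves
  integrality and volume, so the claim moves to the ordered index type while the coefficients stay
  the same.\<close>

lemma unimodular_coordinates_Ints:
  fixes V :: "(real^'n) set" and c :: "real^'n \<Rightarrow> real"
  assumes V: "finite V" "card V = CARD('n)" "0 \<notin> V" "V \<subseteq> lattice"
    and vol: "measure lebesgue (convex hull (insert 0 V)) = 1 / fact CARD('n)"
    and x: "(\<Sum>v\<in>V. c v *\<^sub>R v) \<in> lattice" and v: "v \<in> V"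
  shows "c v \<in> \<int>"
proof -
  obtain h :: "'n ordered_index \<Rightarrow> 'n" where h: "bij h"
    using finite_same_card_bij[of "UNIV :: 'n ordered_index set" "UNIV :: 'n set"]
    by (auto simp: card_ordered_index)
  obtain e0 :: "'n ordered_index \<Rightarrow> real^'n" where e0: "bij_betw e0 UNIV V"
    using finite_same_card_bij[of "UNIV :: 'n ordered_index set" V] V
    by (auto simp: card_ordered_index)
  define R :: "real^'n \<Rightarrow> real^('n ordered_index)" where "R x = (\<chi> j. x $ h j)" for x
  have lin: "linear R" by (auto simp: R_def linear_iff vec_eq_iff)
  have "inj R"
  proof (rule injI)
    fix x y assume "R x = R y"
    then have "x $ h (inv h i) = y $ h (inv h i)" for i by (simp add: R_def vec_eq_iff)
    then show "x = y" using h by (simp add: vec_eq_iff bij_is_surj surj_f_inv_f)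
  qed
  have R0: "R 0 = 0" using lin by (rule linear_0)
  define e where "e = R \<circ> e0"
  have range_e: "range e = R ` V" using e0 by (auto simp: e_def bij_betw_def)
  obtain k where k: "v = e0 k" using e0 v by (auto simp: bij_betw_def)
  have sum_e: "(\<Sum>j\<in>UNIV. c (e0 j) *\<^sub>R e j) = R (\<Sum>v\<in>V. c v *\<^sub>R v)"
    using sum.reindex_bij_betw[OF e0, of "\<lambda>v. c v *\<^sub>R R v"]
    by (simp add: e_def linear_sum[OF lin] linear_cmul[OF lin])
  have "(\<lambda>j. c (e0 j)) k \<in> \<int>"
  proof (rule unimodular_coordinates_Ints_aux)
    show "inj e" using e0 \<open>inj R\<close> by (auto simp: e_def bij_betw_def intro: inj_compose)
    show "0 \<notin> range e" using V(3) R0 \<open>inj R\<close> unfolding range_e by (metis inj_image_mem_iff)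
    show "e j $ i \<in> \<int>" for i j
      using V(4) e0 by (auto simp: e_def R_def lattice_def bij_betw_def)
    show "(\<Sum>j\<in>UNIV. c (e0 j) *\<^sub>R e j) $ i \<in> \<int>" for i
      using x unfolding sum_e by (simp add: R_def lattice_def)
    have "insert 0 (range e) = R ` insert 0 V" by (simp add: range_e R0)
    then have "convex hull (insert 0 (range e)) = R ` (convex hull (insert 0 V))"
      by (simp add: convex_hull_linear_image[OF lin])
    then show "measure lebesgue (convex hull (insert 0 (range e))) = 1 / fact CARD('n ordered_index)"
      using measure_lebesgue_reindex[OF h, of "convex hull (insert 0 V)"] vol V(1)
      by (simp add: R_def[abs_def] finite_imp_compact_convex_hull card_ordered_index)
  qed
  then show ?thesis by (simp add: k)
qed

section \<open>The norm of a positive definite matrix\<close>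

lemma bounded_bilinear_innerM: "bounded_bilinear (innerM (M :: real^'n^'n))"
  unfolding innerM_def
  by (rule bounded_bilinear.comp[OF bounded_bilinear_inner bounded_linear_ident matrix_vector_mul_bounded_linear])

locale spd_matrix =
  fixes M :: "real^'n^'n"
  assumes spd: "sym_pos_definite M"
begin

sublocale inner: bounded_bilinear "innerM M"
  by (rule bounded_bilinear_innerM)

lemma innerM_commute: "innerM M u v = innerM M v u"
proof -
  have "innerM M u v = (transpose M *v u) \<bullet> v"
    by (simp add: innerM_def dot_lmul_matrix)
  then show ?thesis
    using spd by (metis innerM_def sym_pos_definite_def inner_commute)
qed

lemma innerM_self_nonneg [simp]: "0 \<le> innerM M x x"
  using spd by (cases "x = 0") (auto simp: sym_pos_definite_def innerM_def less_imp_le)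

lemma normM_square: "(normM M x)\<^sup>2 = innerM M x x"
  by (simp add: normM_def)

lemma normM_nonneg [simp]: "0 \<le> normM M x"
  by (simp add: normM_def)

lemma normM_pos: "x \<noteq> 0 \<Longrightarrow> 0 < normM M x"
  using spd by (auto simp: sym_pos_definite_def innerM_def normM_def)

lemma normM_zero [simp]: "normM M 0 = 0"
  by (simp add: normM_def inner.zero_left)

lemma normM_eq_0_iff [simp]: "normM M x = 0 \<longleftrightarrow> x = 0"
  using normM_pos[of x] normM_zero by force

lemma normM_scaleR: "normM M (c *\<^sub>R x) = \<bar>c\<bar> * normM M x"
  by (simp add: normM_def inner.scaleR_left inner.scaleR_right real_sqrt_mult flip: mult.assoc)

lemma normM_minus [simp]: "normM M (- x) = normM M x"
  using normM_scaleR[of "-1" x] by simp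

lemma innerM_le_normM: "innerM M u v \<le> normM M u * normM M v"
proof (cases "v = 0")
  case False
  define a b c where "a = innerM M u u" and "b = innerM M u v" and "c = innerM M v v"
  have "c > 0" using normM_pos[OF False] by (simp add: c_def normM_def)
  have "0 \<le> innerM M (c *\<^sub>R u - b *\<^sub>R v) (c *\<^sub>R u - b *\<^sub>R v)" by simp
  also have "\<dots> = c * (a * c - b\<^sup>2)"
    using innerM_commute[of v u]
    by (simp add: inner.diff_left inner.diff_right inner.scaleR_left inner.scaleR_right
        a_def b_def c_def power2_eq_square algebra_simps)
  finally have "b\<^sup>2 \<le> a * c" using \<open>c > 0\<close> by (simp add: zero_le_mult_iff)
  then have "\<bar>b\<bar> \<le> sqrt (a * c)" using real_le_rsqrt by fastforce
  then show ?thesis by (simp add: a_def b_def c_def normM_def real_sqrt_mult)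
qed (simp add: inner.zero_right)

lemma normM_add_square: "(normM M (u + v))\<^sup>2 = (normM M u)\<^sup>2 + 2 * innerM M u v + (normM M v)\<^sup>2"
  using innerM_commute[of v u]
  by (simp add: normM_square inner.add_left inner.add_right)

lemma normM_triangle: "normM M (u + v) \<le> normM M u + normM M v"
proof (rule power2_le_imp_le)
  show "(normM M (u + v))\<^sup>2 \<le> (normM M u + normM M v)\<^sup>2"
    using innerM_le_normM[of u v] by (simp add: normM_add_square power2_sum)
qed simp

lemma normM_sum: "normM M (sum f A) \<le> (\<Sum>a\<in>A. normM M (f a))"
  by (induction A rule: infinite_finite_induct) (auto intro: order_trans[OF normM_triangle])

lemma continuous_on_normM: "continuous_on S (normM M)"
  unfolding normM_def by (intro continuous_intros inner.continuous_on)

lemma normM_ge_norm: "\<exists>c>0. \<forall>x. c * norm x \<le> normM M x"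
proof -
  have "axis undefined 1 \<in> sphere (0 :: real^'n) 1" by simp
  then obtain y where y: "y \<in> sphere 0 1" "\<And>x. x \<in> sphere 0 1 \<Longrightarrow> normM M y \<le> normM M x"
    using continuous_attains_inf[OF compact_sphere _ continuous_on_normM, of 0 1] by blast
  show ?thesis
  proof (intro exI[of _ "normM M y"] conjI allI)
    show "0 < normM M y" using y(1) by (intro normM_pos) auto
    fix x show "normM M y * norm x \<le> normM M x"
    proof (cases "x = 0")
      case False
      then have "normM M y \<le> normM M ((1 / norm x) *\<^sub>R x)" by (intro y(2)) simp
      then show ?thesis using False by (simp add: normM_scaleR field_simps)
    qed simp
  qed
qed

lemma finite_lattice_normM_le: "finite {z \<in> lattice. normM M z \<le> c}"
proof -
  obtain k where k: "k > 0" "\<And>x. k * norm x \<le> normM M x" using normM_ge_norm by blast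
  define R where "R = \<lceil>c / k\<rceil>"
  have "{z \<in> lattice. normM M z \<le> c} \<subseteq> (\<lambda>f. \<chi> i. real_of_int (f i)) ` (UNIV \<rightarrow> {-R..R})"
  proof
    fix z assume "z \<in> {z \<in> lattice. normM M z \<le> c}"
    then have z: "\<And>i. z $ i \<in> \<int>" "normM M z \<le> c" by (auto simp: lattice_def)
    have "\<bar>z $ i\<bar> \<le> R" for i
    proof -
      have "k * \<bar>z $ i\<bar> \<le> c"
        using k z(2) component_le_norm_cart[of z i]
        by (meson mult_left_mono order_trans less_imp_le)
      then have "\<bar>z $ i\<bar> \<le> c / k" using k by (simp add: field_simps)
      then show ?thesis unfolding R_def by linarith
    qed
    then have "\<bar>\<lfloor>z $ i\<rfloor>\<bar> \<le> R" for i
      using z(1)[of i] by (metis floor_of_int of_int_abs of_int_le_iff Ints_cases)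
    then have "(\<lambda>i. \<lfloor>z $ i\<rfloor>) \<in> UNIV \<rightarrow> {-R..R}" by (auto simp: abs_le_iff minus_le_iff)
    moreover have "z = (\<chi> i. real_of_int \<lfloor>z $ i\<rfloor>)"
      using z(1) by (simp add: vec_eq_iff)
    ultimately show "z \<in> (\<lambda>f. \<chi> i. real_of_int (f i)) ` (UNIV \<rightarrow> {-R..R})"
      by (intro image_eqI[where x = "\<lambda>i. \<lfloor>z $ i\<rfloor>"])
  qed
  moreover have "finite ((UNIV :: 'n set) \<rightarrow> {-R..R})"
    using finite_PiE[of "UNIV :: 'n set" "\<lambda>_. {-R..R}"] by (simp add: PiE_def)
  ultimately show ?thesis by (meson finite_imageI finite_subset)
qed

lemma normM_le_on_convex_hull:
  assumes "finite T" "\<And>v. v \<in> T \<Longrightarrow> normM M v \<le> r" "x \<in> convex hull T"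
  shows "normM M x \<le> r"
proof -
  obtain u where u: "\<And>v. v \<in> T \<Longrightarrow> 0 \<le> u v" "sum u T = 1" "(\<Sum>v\<in>T. u v *\<^sub>R v) = x"
    using assms(1,3) by (auto simp: convex_hull_finite)
  have "normM M x \<le> (\<Sum>v\<in>T. normM M (u v *\<^sub>R v))"
    using u(3) normM_sum[of "\<lambda>v. u v *\<^sub>R v" T] by simp
  also have "\<dots> \<le> (\<Sum>v\<in>T. u v * r)"
    using u(1) assms(2) by (intro sum_mono) (simp add: normM_scaleR mult_left_mono)
  finally show ?thesis using u(2) by (simp flip: sum_distrib_right)
qed

text \<open>All cross terms are nonnegative, so only the term of \<open>v\<close> is kept:
  nonnegative combinations of pairwise acute vectors do not cancel. Cauchy-Schwarz then bounds each
  summand by the norm of the whole sum.\<close>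

lemma sum_coeff_le_innerM:
  assumes "finite V" "\<And>u w. u \<in> V \<Longrightarrow> w \<in> V \<Longrightarrow> 0 \<le> innerM M u w"
    and "\<And>w. w \<in> V \<Longrightarrow> 0 \<le> a w" "v \<in> V"
  shows "a v * (normM M v)\<^sup>2 \<le> innerM M (\<Sum>w\<in>V. a w *\<^sub>R w) v"
proof -
  have "a v * (normM M v)\<^sup>2 = (\<Sum>w\<in>{v}. a w * innerM M w v)" by (simp add: normM_square)
  also have "\<dots> \<le> (\<Sum>w\<in>V. a w * innerM M w v)" using assms by (intro sum_mono2) auto
  finally show ?thesis by (simp add: inner.sum_left inner.scaleR_left)
qed

lemma coeff_le_normM:
  assumes "finite V" "\<And>u w. u \<in> V \<Longrightarrow> w \<in> V \<Longrightarrow> 0 \<le> innerM M u w"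
    and "\<And>w. w \<in> V \<Longrightarrow> 0 \<le> a w" "v \<in> V"
  shows "a v * normM M v \<le> normM M (\<Sum>w\<in>V. a w *\<^sub>R w)"
proof (cases "v = 0")
  case False
  have "a v * normM M v * normM M v \<le> normM M (\<Sum>w\<in>V. a w *\<^sub>R w) * normM M v"
    using sum_coeff_le_innerM[OF assms] innerM_le_normM order_trans
    by (fastforce simp: power2_eq_square mult.assoc)
  then show ?thesis using normM_pos[OF False] by simp
qed simp

end

section \<open>The Hopf--Lax operator\<close>

locale reduced_mesh = spd_matrix M for M :: "real^'n^'n" +
  fixes \<T> :: "(real^'n) set set"
  assumes mesh: "M_reduced_mesh M \<T>"
begin

text \<open>A choice of fewer than d vertices is encoded by zero weights on the others. By the
  convention 0 * infinity = 0 these contribute nothing, even where the value is infinite.\<close>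

definition weights :: "(real^'n) set \<Rightarrow> (real^'n \<Rightarrow> real) \<Rightarrow> bool" where
  "weights T \<alpha> \<longleftrightarrow> (\<forall>v\<in>T - {0}. 0 \<le> \<alpha> v) \<and> sum \<alpha> (T - {0}) = 1"

lemma finite_mesh: "finite \<T>"
  and zero_interior: "0 \<in> interior (\<Union>T\<in>\<T>. convex hull T)"
  using mesh by (auto simp: M_reduced_mesh_def)

lemma
  assumes "T \<in> \<T>"
  shows finite_simplex: "finite T"
    and card_vertices: "card (T - {0}) = CARD('n)"
    and simplex_lattice: "T \<subseteq> lattice"
    and zero_in_simplex: "0 \<in> T"
    and simplex_acute: "\<And>u v. u \<in> T \<Longrightarrow> v \<in> T \<Longrightarrow> 0 \<le> innerM M u v"
    and simplex_volume: "measure lebesgue (convex hull T) = 1 / fact CARD('n)"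
proof -
  have T: "finite T" "card T = CARD('n) + 1" "T \<subseteq> lattice" "0 \<in> T"
    "measure lebesgue (convex hull T) = 1 / fact CARD('n)"
    "\<And>u v. u \<in> T \<Longrightarrow> v \<in> T \<Longrightarrow> u \<noteq> 0 \<Longrightarrow> v \<noteq> 0 \<Longrightarrow> 0 \<le> innerM M u v"
    using mesh assms unfolding M_reduced_mesh_def by auto
  show "finite T" "T \<subseteq> lattice" "0 \<in> T" "measure lebesgue (convex hull T) = 1 / fact CARD('n)"
    by (fact T)+
  show "card (T - {0}) = CARD('n)" using T by simp
  show "0 \<le> innerM M u v" if "u \<in> T" "v \<in> T" for u v
    using T(6)[OF that] by (cases "u = 0 \<or> v = 0") (auto simp: inner.zero_left inner.zero_right)
qed

lemma vertices_nonempty: "T \<in> \<T> \<Longrightarrow> T - {0} \<noteq> {}"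
  using card_vertices[of T] by (metis card.empty zero_less_card_finite less_irrefl)

lemma mesh_nonempty: "\<T> \<noteq> {}"
  using zero_interior by auto

lemma lattice_add: "x \<in> lattice \<Longrightarrow> y \<in> lattice \<Longrightarrow> x + y \<in> (lattice :: (real^'n) set)"
  by (auto simp: lattice_def)

lemma lattice_step: "z \<in> lattice \<Longrightarrow> T \<in> \<T> \<Longrightarrow> v \<in> T \<Longrightarrow> z + v \<in> lattice"
  using lattice_add simplex_lattice by blast

lemma vertex_coeff_le_normM:
  assumes "T \<in> \<T>" "\<And>w. w \<in> T - {0} \<Longrightarrow> 0 \<le> a w" "v \<in> T - {0}"
  shows "a v * normM M v \<le> normM M (\<Sum>w\<in>T - {0}. a w *\<^sub>R w)"
  using assms finite_simplex simplex_acute by (intro coeff_le_normM) auto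

lemma HopfLax_mono:
  assumes "\<And>T v. T \<in> \<T> \<Longrightarrow> v \<in> T \<Longrightarrow> W (z + v) \<le> W' (z + v)"
  shows "HopfLax M \<T> W z \<le> HopfLax M \<T> W' z"
  unfolding HopfLax_def
proof (rule Inf_mono, clarify)
  fix k and \<alpha> :: "nat \<Rightarrow> real" and v :: "nat \<Rightarrow> real^'n" and T
  assume *: "1 \<le> k" "k \<le> CARD('n)" "\<forall>i<k. 0 \<le> \<alpha> i" "sum \<alpha> {..<k} = 1" "T \<in> \<T>" "\<forall>i<k. v i \<in> T \<and> v i \<noteq> 0"
  have "(\<Sum>i<k. ennreal (\<alpha> i) * W (z + v i)) \<le> (\<Sum>i<k. ennreal (\<alpha> i) * W' (z + v i))"
    using * assms by (intro sum_mono mult_left_mono) auto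
  then show "\<exists>a\<in>{ennreal (normM M (\<Sum>i<k. \<alpha> i *\<^sub>R v i)) + (\<Sum>i<k. ennreal (\<alpha> i) * W (z + v i)) |k \<alpha> v.
              1 \<le> k \<and> k \<le> CARD('n) \<and> (\<forall>i<k. 0 \<le> \<alpha> i) \<and> sum \<alpha> {..<k} = 1 \<and> (\<exists>T\<in>\<T>. \<forall>i<k. v i \<in> T \<and> v i \<noteq> 0)}.
          a \<le> ennreal (normM M (\<Sum>i<k. \<alpha> i *\<^sub>R v i)) + (\<Sum>i<k. ennreal (\<alpha> i) * W' (z + v i))"
    using * by (intro bexI[of _ "ennreal (normM M (\<Sum>i<k. \<alpha> i *\<^sub>R v i)) + (\<Sum>i<k. ennreal (\<alpha> i) * W (z + v i))"]
        add_left_mono CollectI exI[of _ k] exI[of _ \<alpha>] exI[of _ v] conjI refl bexI[of _ T]) auto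
qed

lemma HopfLax_cong_lattice:
  assumes "z \<in> lattice" "\<And>y. y \<in> lattice \<Longrightarrow> W y = W' y"
  shows "HopfLax M \<T> W z = HopfLax M \<T> W' z"
  using assms lattice_step by (intro antisym HopfLax_mono) auto

lemma HopfLax_le:
  assumes "T \<in> \<T>" "weights T \<alpha>"
  shows "HopfLax M \<T> W z \<le> ennreal (normM M (\<Sum>v\<in>T - {0}. \<alpha> v *\<^sub>R v)) + (\<Sum>v\<in>T - {0}. ennreal (\<alpha> v) * W (z + v))"
proof -
  have fin: "finite (T - {0})" using finite_simplex[OF assms(1)] by simp
  obtain h where "bij_betw h {0..<CARD('n)} (T - {0})"
    using ex_bij_betw_nat_finite[OF fin] card_vertices[OF assms(1)] by auto
  then have h: "bij_betw h {..<CARD('n)} (T - {0})" by (simp add: atLeast0LessThan)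
  have hT: "h i \<in> T - {0}" if "i < CARD('n)" for i using h that by (auto simp: bij_betw_def)
  note R = sum.reindex_bij_betw[OF h]
  show ?thesis
    unfolding HopfLax_def
  proof (rule Inf_lower, intro CollectI exI conjI)
    show "ennreal (normM M (\<Sum>v\<in>T - {0}. \<alpha> v *\<^sub>R v)) + (\<Sum>v\<in>T - {0}. ennreal (\<alpha> v) * W (z + v)) =
      ennreal (normM M (\<Sum>i<CARD('n). (\<alpha> \<circ> h) i *\<^sub>R h i)) + (\<Sum>i<CARD('n). ennreal ((\<alpha> \<circ> h) i) * W (z + h i))"
      using R[of "\<lambda>v. \<alpha> v *\<^sub>R v"] R[of "\<lambda>v. ennreal (\<alpha> v) * W (z + v)"] by simp
    show "(\<Sum>i<CARD('n). (\<alpha> \<circ> h) i) = 1"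
      using R[of \<alpha>] assms(2) by (simp add: weights_def)
  qed (use hT assms in \<open>auto simp: weights_def Suc_le_eq\<close>)
qed

lemma HopfLax_le_real:
  assumes "T \<in> \<T>" "weights T \<alpha>" "\<And>v. v \<in> T - {0} \<Longrightarrow> 0 \<le> \<delta> (z + v)"
  shows "HopfLax M \<T> (\<lambda>y. ennreal (\<delta> y)) z \<le>
    ennreal (normM M (\<Sum>v\<in>T - {0}. \<alpha> v *\<^sub>R v) + (\<Sum>v\<in>T - {0}. \<alpha> v * \<delta> (z + v)))"
proof -
  have "(\<Sum>v\<in>T - {0}. ennreal (\<alpha> v) * ennreal (\<delta> (z + v))) = ennreal (\<Sum>v\<in>T - {0}. \<alpha> v * \<delta> (z + v))"
    using assms by (subst sum_ennreal[symmetric]) (auto simp: weights_def ennreal_mult intro!: sum.cong)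
  moreover have "0 \<le> (\<Sum>v\<in>T - {0}. \<alpha> v * \<delta> (z + v))"
    using assms by (intro sum_nonneg mult_nonneg_nonneg) (auto simp: weights_def)
  ultimately show ?thesis
    using HopfLax_le[OF assms(1,2), of "\<lambda>y. ennreal (\<delta> y)" z] by (simp add: ennreal_plus)
qed

text \<open>The objective depends on the weights only through the point
  \<open>(\<Sum> \<alpha> v *\<^sub>R v, \<Sum> \<alpha> v * \<delta> (z + v))\<close>, which ranges over a finite union of convex hulls of finite sets.\<close>

lemma HopfLax_attained:
  assumes z: "z \<in> lattice" and \<delta>: "\<And>y. y \<in> lattice \<Longrightarrow> 0 \<le> \<delta> y"
  obtains T \<alpha> where "T \<in> \<T>" "weights T \<alpha>"
    "HopfLax M \<T> (\<lambda>y. ennreal (\<delta> y)) z =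
      ennreal (normM M (\<Sum>v\<in>T - {0}. \<alpha> v *\<^sub>R v) + (\<Sum>v\<in>T - {0}. \<alpha> v * \<delta> (z + v)))"
proof -
  \<comment> \<open>Keeping \<open>v\<close> as the first component makes \<open>lift\<close>
    injective, so convex coefficients on the lifted vertices pull back to weights on the
    vertices.\<close>
  define lift where "lift v = (v, \<delta> (z + v))" for v
  define P where "P = (\<Union>T\<in>\<T>. convex hull (lift ` (T - {0})))"
  define obj where "obj p = normM M (fst p) + snd p" for p
  have "compact P"
    unfolding P_def using finite_mesh finite_simplex
    by (intro compact_UN finite_imp_compact_convex_hull) auto
  moreover have "P \<noteq> {}" using mesh_nonempty vertices_nonempty by (auto simp: P_def)
  moreover have "continuous_on P obj"
    unfolding obj_def
    by (intro continuous_on_add continuous_on_snd continuous_on_id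
        continuous_on_compose2[OF continuous_on_normM[of UNIV]] continuous_on_fst) simp_all
  ultimately have "\<exists>p\<in>P. \<forall>q\<in>P. obj p \<le> obj q" by (rule continuous_attains_inf)
  then obtain p where p: "p \<in> P" "\<And>q. q \<in> P \<Longrightarrow> obj p \<le> obj q" by blast
  from p(1) obtain T where T: "T \<in> \<T>" "p \<in> convex hull (lift ` (T - {0}))" by (auto simp: P_def)
  have fin: "finite (T - {0})" using finite_simplex[OF T(1)] by simp
  obtain u where u: "\<forall>x\<in>lift ` (T - {0}). 0 \<le> u x" "sum u (lift ` (T - {0})) = 1"
    "(\<Sum>x\<in>lift ` (T - {0}). u x *\<^sub>R x) = p"
    using T(2) convex_hull_finite[of "lift ` (T - {0})"] fin by auto
  have inj: "inj_on lift (T - {0})" by (auto simp: inj_on_def lift_def)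
  define \<alpha> where "\<alpha> v = u (lift v)" for v
  have w: "weights T \<alpha>" using u(1,2) inj by (auto simp: weights_def \<alpha>_def sum.reindex)
  have "p = (\<Sum>v\<in>T - {0}. \<alpha> v *\<^sub>R lift v)" using u(3) inj by (simp add: \<alpha>_def sum.reindex)
  then have obj_p: "obj p = normM M (\<Sum>v\<in>T - {0}. \<alpha> v *\<^sub>R v) + (\<Sum>v\<in>T - {0}. \<alpha> v * \<delta> (z + v))"
    by (simp add: obj_def lift_def fst_sum snd_sum)
  have \<delta>T: "0 \<le> \<delta> (z + v)" if "T \<in> \<T>" "v \<in> T" for T v using \<delta> lattice_step[OF z] that by blast
  have "HopfLax M \<T> (\<lambda>y. ennreal (\<delta> y)) z = ennreal (obj p)"
  proof (rule antisym)
    show "HopfLax M \<T> (\<lambda>y. ennreal (\<delta> y)) z \<le> ennreal (obj p)"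
      unfolding obj_p using T(1) w \<delta>T by (intro HopfLax_le_real) auto
    show "ennreal (obj p) \<le> HopfLax M \<T> (\<lambda>y. ennreal (\<delta> y)) z"
      unfolding HopfLax_def
    proof (rule Inf_greatest, clarify)
      fix k and \<beta> :: "nat \<Rightarrow> real" and v :: "nat \<Rightarrow> real^'n" and S
      assume *: "1 \<le> k" "k \<le> CARD('n)" "\<forall>i<k. 0 \<le> \<beta> i" "sum \<beta> {..<k} = 1" "S \<in> \<T>" "\<forall>i<k. v i \<in> S \<and> v i \<noteq> 0"
      define q where "q = (\<Sum>i<k. \<beta> i *\<^sub>R lift (v i))"
      \<comment> \<open>The vertices \<open>v i\<close> may repeat, so the sum runs over indices;
        membership in the hull holds all the same.\<close>
      have "q \<in> convex hull (lift ` (S - {0}))"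
        unfolding q_def using * by (intro convex_sum convex_convex_hull) (auto intro: hull_inc)
      then have "q \<in> P" using *(5) unfolding P_def by blast
      then have "obj p \<le> obj q" by (rule p(2))
      also have "obj q = normM M (\<Sum>i<k. \<beta> i *\<^sub>R v i) + (\<Sum>i<k. \<beta> i * \<delta> (z + v i))"
        by (simp add: q_def obj_def lift_def fst_sum snd_sum)
      finally have "ennreal (obj p) \<le> ennreal (normM M (\<Sum>i<k. \<beta> i *\<^sub>R v i) + (\<Sum>i<k. \<beta> i * \<delta> (z + v i)))"
        by (rule ennreal_leI)
      also have "\<dots> = ennreal (normM M (\<Sum>i<k. \<beta> i *\<^sub>R v i)) + ennreal (\<Sum>i<k. \<beta> i * \<delta> (z + v i))"
        using * \<delta>T by (intro ennreal_plus normM_nonneg sum_nonneg mult_nonneg_nonneg) auto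
      also have "ennreal (\<Sum>i<k. \<beta> i * \<delta> (z + v i)) = (\<Sum>i<k. ennreal (\<beta> i) * ennreal (\<delta> (z + v i)))"
        using * \<delta>T by (subst sum_ennreal[symmetric]) (auto simp: ennreal_mult intro!: sum.cong)
      finally show "ennreal (obj p) \<le> ennreal (normM M (\<Sum>i<k. \<beta> i *\<^sub>R v i)) + (\<Sum>i<k. ennreal (\<beta> i) * ennreal (\<delta> (z + v i)))" .
    qed
  qed
  then show ?thesis using that[OF T(1) w] obj_p by simp
qed

subsection \<open>Causality and comparison\<close>

lemma solution_le:
  assumes "is_solution M \<T> \<delta>" "z \<in> lattice - {0}" "T \<in> \<T>" "weights T \<alpha>"
  shows "\<delta> z \<le> normM M (\<Sum>v\<in>T - {0}. \<alpha> v *\<^sub>R v) + (\<Sum>v\<in>T - {0}. \<alpha> v * \<delta> (z + v))"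
proof -
  have nonneg: "0 \<le> \<delta> (z + v)" if "v \<in> T" for v
    using assms lattice_step that by (auto simp: is_solution_def)
  then have "ennreal (\<delta> z) \<le> ennreal (normM M (\<Sum>v\<in>T - {0}. \<alpha> v *\<^sub>R v) + (\<Sum>v\<in>T - {0}. \<alpha> v * \<delta> (z + v)))"
    using HopfLax_le_real[OF assms(3,4), of \<delta> z] assms(1,2) by (simp add: is_solution_def)
  moreover have "0 \<le> normM M (\<Sum>v\<in>T - {0}. \<alpha> v *\<^sub>R v) + (\<Sum>v\<in>T - {0}. \<alpha> v * \<delta> (z + v))"
    using nonneg assms(4) by (intro add_nonneg_nonneg sum_nonneg mult_nonneg_nonneg) (auto simp: weights_def)
  ultimately show ?thesis by (simp add: ennreal_le_iff)
qed

lemma solution_causal: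
  assumes sol: "is_solution M \<T> \<delta>" and z: "z \<in> lattice - {0}"
  obtains T \<alpha> where "T \<in> \<T>" "weights T \<alpha>"
    "\<delta> z = normM M (\<Sum>v\<in>T - {0}. \<alpha> v *\<^sub>R v) + (\<Sum>v\<in>T - {0}. \<alpha> v * \<delta> (z + v))"
    "\<And>v. v \<in> T - {0} \<Longrightarrow> 0 < \<alpha> v \<Longrightarrow> \<delta> (z + v) < \<delta> z"
proof -
  have \<delta>: "\<And>y. y \<in> lattice \<Longrightarrow> 0 \<le> \<delta> y" using sol by (simp add: is_solution_def)
  from z have zl: "z \<in> lattice" by simp
  obtain T \<alpha> where T: "T \<in> \<T>" and w: "weights T \<alpha>" and "HopfLax M \<T> (\<lambda>y. ennreal (\<delta> y)) z =
      ennreal (normM M (\<Sum>v\<in>T - {0}. \<alpha> v *\<^sub>R v) + (\<Sum>v\<in>T - {0}. \<alpha> v * \<delta> (z + v)))"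
    using HopfLax_attained[where \<delta> = \<delta>, OF zl] \<delta> by blast
  then have "ennreal (\<delta> z) = ennreal (normM M (\<Sum>v\<in>T - {0}. \<alpha> v *\<^sub>R v) + (\<Sum>v\<in>T - {0}. \<alpha> v * \<delta> (z + v)))"
    using sol z by (simp add: is_solution_def)
  moreover have \<delta>T: "0 \<le> \<delta> (z + v)" if "v \<in> T" for v using \<delta> lattice_step[OF zl T] that by blast
  moreover have \<alpha>: "\<And>v. v \<in> T - {0} \<Longrightarrow> 0 \<le> \<alpha> v" using w by (simp add: weights_def)
  ultimately have eq: "\<delta> z = normM M (\<Sum>v\<in>T - {0}. \<alpha> v *\<^sub>R v) + (\<Sum>v\<in>T - {0}. \<alpha> v * \<delta> (z + v))"
    using \<delta>[OF zl] by (subst (asm) ennreal_inj) (auto intro!: add_nonneg_nonneg sum_nonneg mult_nonneg_nonneg)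
  have "\<delta> (z + u) < \<delta> z" if u: "u \<in> T - {0}" "0 < \<alpha> u" for u
  proof (rule ccontr)
    assume "\<not> \<delta> (z + u) < \<delta> z"
    then have ge: "\<delta> z \<le> \<delta> (z + u)" by simp
    define V where "V = T - {0} - {u}"
    define x' where "x' = (\<Sum>v\<in>V. \<alpha> v *\<^sub>R v)"
    define b where "b = (\<Sum>v\<in>V. \<alpha> v * \<delta> (z + v))"
    have fin: "finite (T - {0})" using finite_simplex[OF T] by simp
    have V: "v \<in> T" "v \<noteq> 0" "0 \<le> \<alpha> v" if "v \<in> V" for v using that \<alpha> by (auto simp: V_def)
    have split: "sum g (T - {0}) = g u + sum g V" for g :: "real^'n \<Rightarrow> 'z::comm_monoid_add"
      unfolding V_def using fin u(1) by (rule sum.remove)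
    have "0 \<le> innerM M x' u"
      unfolding x'_def inner.sum_left inner.scaleR_left
      using V u simplex_acute[OF T] by (intro sum_nonneg) auto
    then have "0 \<le> innerM M x' (\<alpha> u *\<^sub>R u)" using u(2) by (simp add: inner.scaleR_right)
    moreover have "0 < normM M (\<alpha> u *\<^sub>R u)" using u by (intro normM_pos) auto
    \<comment> \<open>Acuteness enters here: removing the part along \<open>u\<close> strictly
      shortens the step.\<close>
    ultimately have "(normM M x')\<^sup>2 < (normM M (x' + \<alpha> u *\<^sub>R u))\<^sup>2"
      unfolding normM_add_square using zero_less_power[of "normM M (\<alpha> u *\<^sub>R u)" 2] by linarith
    then have lt: "normM M x' < normM M (x' + \<alpha> u *\<^sub>R u)" by (rule power2_less_imp_less) simp
    have "\<delta> z = normM M (x' + \<alpha> u *\<^sub>R u) + (\<alpha> u * \<delta> (z + u) + b)"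
      using eq by (simp add: split x'_def b_def add.commute)
    moreover have "\<alpha> u * \<delta> z \<le> \<alpha> u * \<delta> (z + u)" using ge u(2) by simp
    ultimately have main: "normM M x' + b < (1 - \<alpha> u) * \<delta> z" using lt by (simp add: algebra_simps)
    have sum1: "\<alpha> u + sum \<alpha> V = 1" using w by (simp add: weights_def split)
    have b: "0 \<le> b" using V \<delta>T by (auto simp: b_def intro!: sum_nonneg)
    \<comment> \<open>This excludes that \<open>u\<close> carries all the weight, so the remaining
      weights can be renormalized: the left side of \<open>main\<close> is nonnegative.\<close>
    have "0 < (1 - \<alpha> u) * \<delta> z" using main b normM_nonneg[of x'] by linarith
    then have pos: "0 < 1 - \<alpha> u" using \<delta>[OF zl] by (simp add: zero_less_mult_iff)
    define \<beta> where "\<beta> v = (if v = u then 0 else \<alpha> v / (1 - \<alpha> u))" for v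
    have "sum \<beta> V = sum \<alpha> V / (1 - \<alpha> u)" by (simp add: \<beta>_def V_def sum_divide_distrib)
    then have "weights T \<beta>"
      using pos \<alpha> sum1 by (auto simp: weights_def split \<beta>_def)
    from solution_le[OF sol z T this]
    have "\<delta> z \<le> normM M (\<Sum>v\<in>V. \<beta> v *\<^sub>R v) + (\<Sum>v\<in>V. \<beta> v * \<delta> (z + v))"
      by (simp add: split \<beta>_def)
    also have "(\<Sum>v\<in>V. \<beta> v *\<^sub>R v) = (1 / (1 - \<alpha> u)) *\<^sub>R x'"
      unfolding x'_def scaleR_sum_right by (intro sum.cong) (auto simp: \<beta>_def V_def)
    also have "(\<Sum>v\<in>V. \<beta> v * \<delta> (z + v)) = b / (1 - \<alpha> u)"
      unfolding b_def sum_divide_distrib by (intro sum.cong) (auto simp: \<beta>_def V_def)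
    finally have "\<delta> z \<le> (normM M x' + b) / (1 - \<alpha> u)"
      using pos by (simp add: normM_scaleR add_divide_distrib)
    then show False using main pos by (simp add: field_simps)
  qed
  then show ?thesis using that[OF T w eq] by blast
qed

section \<open>Uniform step bounds, finite sublevel sets and comparison\<close>

lemma vertex_norm_lower_bound:
  obtains \<mu> where "0 < \<mu>" "\<And>T v. T \<in> \<T> \<Longrightarrow> v \<in> T - {0} \<Longrightarrow> \<mu> \<le> normM M v"
proof -
  define N where "N = normM M ` (\<Union>\<T> - {0})"
  have fin: "finite N" using finite_mesh finite_simplex by (auto simp: N_def)
  have ne: "N \<noteq> {}" using mesh_nonempty vertices_nonempty by (fastforce simp: N_def)
  show ?thesis
  proof (rule that[of "Min N"])
    have "Min N \<in> N" using fin ne by (rule Min_in)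
    then show "0 < Min N" by (auto simp: N_def intro: normM_pos)
    show "Min N \<le> normM M v" if "T \<in> \<T>" "v \<in> T - {0}" for T v
      using that fin by (intro Min_le) (auto simp: N_def)
  qed
qed

lemma vertex_norm_upper_bound:
  obtains r where "0 < r" "\<And>T v. T \<in> \<T> \<Longrightarrow> v \<in> T \<Longrightarrow> normM M v \<le> r"
proof -
  have "finite (normM M ` \<Union>\<T>)" using finite_mesh finite_simplex by auto
  then have "bdd_above (normM M ` \<Union>\<T>)" by (rule bdd_above_finite)
  then obtain r where "\<And>x. x \<in> normM M ` \<Union>\<T> \<Longrightarrow> x \<le> r" by (meson bdd_above_def)
  then show ?thesis by (intro that[of "max r 1"]) (auto simp: le_max_iff_disj)
qed

text \<open>Some weight is at least 1 / d, and in an acute simplex the other summands cannot shorten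
  the contribution of its vertex. This is the least cost of one update.\<close>

lemma weighted_normM_ge:
  assumes "T \<in> \<T>" "weights T \<alpha>" "\<And>v. v \<in> T - {0} \<Longrightarrow> \<mu> \<le> normM M v"
  shows "\<mu> / CARD('n) \<le> normM M (\<Sum>v\<in>T - {0}. \<alpha> v *\<^sub>R v)"
proof -
  have "\<exists>v\<in>T - {0}. 1 / CARD('n) \<le> \<alpha> v"
  proof (rule ccontr)
    assume "\<not> ?thesis"
    then have "sum \<alpha> (T - {0}) < (\<Sum>v\<in>T - {0}. 1 / CARD('n))"
      using vertices_nonempty[OF assms(1)] finite_simplex[OF assms(1)]
      by (intro sum_strict_mono) (simp_all add: not_le)
    then show False using assms(2) card_vertices[OF assms(1)] by (simp add: weights_def)
  qed
  then obtain v where v: "v \<in> T - {0}" "1 / CARD('n) \<le> \<alpha> v" by blast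
  have "\<mu> / CARD('n) \<le> 1 / CARD('n) * normM M v" using assms(3)[OF v(1)] by (simp add: divide_right_mono)
  also have "\<dots> \<le> \<alpha> v * normM M v" using v(2) by (intro mult_right_mono) auto
  also have "\<dots> \<le> normM M (\<Sum>v\<in>T - {0}. \<alpha> v *\<^sub>R v)"
    using assms(1,2) v(1) by (intro vertex_coeff_le_normM) (auto simp: weights_def)
  finally show ?thesis .
qed

text \<open>Every update raises the value by a fixed amount over some neighbour, so the value
  dominates the number of mesh steps to the origin.\<close>

lemma finite_sublevel:
  assumes sol: "is_solution M \<T> \<delta>"
  shows "finite {z \<in> lattice. \<delta> z \<le> c}"
proof -
  obtain \<mu> where \<mu>: "0 < \<mu>" "\<And>T v. T \<in> \<T> \<Longrightarrow> v \<in> T - {0} \<Longrightarrow> \<mu> \<le> normM M v"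
    using vertex_norm_lower_bound by blast
  obtain r where r: "0 < r" "\<And>T v. T \<in> \<T> \<Longrightarrow> v \<in> T \<Longrightarrow> normM M v \<le> r"
    using vertex_norm_upper_bound by blast
  define h where "h = \<mu> / CARD('n)"
  have "0 < h" using \<mu>(1) by (simp add: h_def)
  \<comment> \<open>The strict inequality makes n = 0 vacuous, because a solution is nonnegative.
    Each further \<open>h\<close> of value allows one more step, of length at most
    \<open>r\<close>.\<close>
  have bound: "normM M z \<le> real n * r" if "z \<in> lattice" "\<delta> z < real n * h" for n z
    using that
  proof (induction n arbitrary: z)
    case 0
    then show ?case using sol by (force simp: is_solution_def)
  next
    case (Suc n)
    show ?case
    proof (cases "z = 0")
      case False
      with Suc.prems have z: "z \<in> lattice - {0}" by simp
      obtain T \<alpha> where T: "T \<in> \<T>" "weights T \<alpha>"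
        and eq: "\<delta> z = normM M (\<Sum>v\<in>T - {0}. \<alpha> v *\<^sub>R v) + (\<Sum>v\<in>T - {0}. \<alpha> v * \<delta> (z + v))"
        by (rule solution_causal[OF sol z]) blast
      \<comment> \<open>If all neighbours had values above \<open>\<delta> z - h\<close>, so would
        their weighted average; adding the step cost, which is at least \<open>h\<close>, would
        exceed \<open>\<delta> z\<close>.\<close>
      have "\<exists>v\<in>T - {0}. \<delta> (z + v) \<le> \<delta> z - h"
      proof (rule ccontr)
        assume "\<not> ?thesis"
        then have gap: "\<delta> z - h < \<delta> (z + v)" if "v \<in> T - {0}" for v using that by (simp add: not_le)
        have \<alpha>: "0 \<le> \<alpha> v" if "v \<in> T - {0}" for v using T(2) that by (simp add: weights_def)
        have "\<exists>v\<in>T - {0}. 0 < \<alpha> v"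
        proof (rule ccontr)
          assume "\<not> ?thesis"
          then have "sum \<alpha> (T - {0}) \<le> 0" by (intro sum_nonpos) (simp add: not_less)
          then show False using T(2) by (simp add: weights_def)
        qed
        then obtain u where u: "u \<in> T - {0}" "0 < \<alpha> u" by blast
        have "(\<Sum>v\<in>T - {0}. \<alpha> v * (\<delta> z - h)) < (\<Sum>v\<in>T - {0}. \<alpha> v * \<delta> (z + v))"
        proof (rule sum_strict_mono_ex1)
          show "finite (T - {0})" using finite_simplex[OF T(1)] by simp
          show "\<forall>v\<in>T - {0}. \<alpha> v * (\<delta> z - h) \<le> \<alpha> v * \<delta> (z + v)"
            using gap \<alpha> by (intro ballI mult_left_mono) (auto simp: less_imp_le)
          show "\<exists>v\<in>T - {0}. \<alpha> v * (\<delta> z - h) < \<alpha> v * \<delta> (z + v)"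
            using gap[OF u(1)] u by (intro bexI[of _ u]) auto
        qed
        moreover have "h \<le> normM M (\<Sum>v\<in>T - {0}. \<alpha> v *\<^sub>R v)"
          using weighted_normM_ge[OF T] \<mu>(2)[OF T(1)] by (simp add: h_def)
        ultimately show False
          using eq T(2) by (simp add: weights_def flip: sum_distrib_right)
      qed
      then obtain v where v: "v \<in> T - {0}" "\<delta> (z + v) \<le> \<delta> z - h" by blast
      have "normM M (z + v) \<le> real n * r"
      proof (rule Suc.IH)
        show "z + v \<in> lattice" using lattice_step[OF Suc.prems(1) T(1)] v(1) by blast
        show "\<delta> (z + v) < real n * h" using v(2) Suc.prems(2) by (simp add: algebra_simps)
      qed
      moreover have "normM M z \<le> normM M (z + v) + normM M v"
        using normM_triangle[of "z + v" "- v"] by simp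
      moreover have "normM M v \<le> r" using r(2) v T(1) by blast
      ultimately show ?thesis by (simp add: algebra_simps)
    qed (use r in simp)
  qed
  obtain n :: nat where "c / h < real n" using reals_Archimedean2 by blast
  then have n: "c < real n * h" using \<open>0 < h\<close> by (simp add: field_simps)
  have "{z \<in> lattice. \<delta> z \<le> c} \<subseteq> {z \<in> lattice. normM M z \<le> real n * r}"
    using bound[of _ n] n by fastforce
  then show ?thesis using finite_lattice_normM_le finite_subset by blast
qed

text \<open>At a violation y with least \<open>\<delta> y\<close>, causality gives every neighbour
  of positive weight a smaller value, hence no violation there; averaging with the optimal weights
  of \<open>\<delta>\<close> then contradicts the violation at y. Applied with \<open>a\<close> the
  norm it gives the lower bound, with \<open>a\<close> another solution uniqueness.\<close>

lemma subsolution_le_solution: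
  assumes sol: "is_solution M \<T> \<delta>" and a0: "a 0 \<le> 0"
    and sub: "\<And>z T \<alpha>. z \<in> lattice - {0} \<Longrightarrow> T \<in> \<T> \<Longrightarrow> weights T \<alpha> \<Longrightarrow>
      a z \<le> normM M (\<Sum>v\<in>T - {0}. \<alpha> v *\<^sub>R v) + (\<Sum>v\<in>T - {0}. \<alpha> v * a (z + v))"
    and z: "z \<in> lattice"
  shows "a z \<le> \<delta> z"
proof (rule ccontr)
  assume neg: "\<not> a z \<le> \<delta> z"
  \<comment> \<open>The cap by \<open>\<delta> z\<close> places \<open>B\<close> in a finite
    sublevel set, so a least violation exists.\<close>
  define B where "B = {y \<in> lattice. \<delta> y < a y \<and> \<delta> y \<le> \<delta> z}"
  have "finite B" using finite_sublevel[OF sol, of "\<delta> z"] by (rule rev_finite_subset) (auto simp: B_def)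
  moreover have "z \<in> B" using z neg by (simp add: B_def)
  ultimately have "\<exists>y. is_arg_min \<delta> (\<lambda>y. y \<in> B) y" by (intro ex_is_arg_min_if_finite) auto
  then obtain y where y: "y \<in> B" "\<And>x. x \<in> B \<Longrightarrow> \<delta> y \<le> \<delta> x" by (auto simp: is_arg_min_linorder)
  have "y \<noteq> 0" using y(1) a0 sol by (auto simp: B_def is_solution_def)
  then have yl: "y \<in> lattice - {0}" using y(1) by (simp add: B_def)
  obtain T \<alpha> where T: "T \<in> \<T>" and w: "weights T \<alpha>"
    and eq: "\<delta> y = normM M (\<Sum>v\<in>T - {0}. \<alpha> v *\<^sub>R v) + (\<Sum>v\<in>T - {0}. \<alpha> v * \<delta> (y + v))"
    and less: "\<And>v. v \<in> T - {0} \<Longrightarrow> 0 < \<alpha> v \<Longrightarrow> \<delta> (y + v) < \<delta> y"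
    by (rule solution_causal[OF sol yl]) blast
  have "\<alpha> v * a (y + v) \<le> \<alpha> v * \<delta> (y + v)" if v: "v \<in> T - {0}" for v
  proof (cases "\<alpha> v = 0")
    case False
    then have pos: "0 < \<alpha> v" using w v by (auto simp: weights_def less_le)
    have "y + v \<notin> B" using y(2)[of "y + v"] less[OF v pos] by auto
    then have "a (y + v) \<le> \<delta> (y + v)"
      using less[OF v pos] y(1) lattice_step[OF _ T, of y v] v by (auto simp: B_def)
    then show ?thesis using pos by simp
  qed simp
  then have "a y \<le> \<delta> y"
    unfolding eq by (intro order_trans[OF sub[OF yl T w]] add_left_mono sum_mono)
  then show False using y(1) by (simp add: B_def)
qed

subsection \<open>Error estimate and existence\<close>

text \<open>Acuteness passes from the vertices to the whole simplex by bilinearity. With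
  Cauchy-Schwarz the infimum defining the angle lies in [0, 1], where \<open>cos\<close> inverts
  \<open>arccos\<close>.\<close>

lemma
  assumes T: "T \<in> \<T>"
  shows cos_thetaM_nonneg: "0 \<le> cos (thetaM M T)"
    and innerM_ge_cos_thetaM: "\<And>u v. u \<in> convex hull T \<Longrightarrow> v \<in> convex hull T \<Longrightarrow>
      cos (thetaM M T) * normM M u * normM M v \<le> innerM M u v"
proof -
  define Q where "Q = {innerM M u v / (normM M u * normM M v) | u v.
    u \<in> convex hull T - {0} \<and> v \<in> convex hull T - {0}}"
  have acute: "0 \<le> innerM M u v" if uv: "u \<in> convex hull T" "v \<in> convex hull T" for u v
  proof -
    obtain a where a: "\<forall>x\<in>T. 0 \<le> a x" "(\<Sum>x\<in>T. a x *\<^sub>R x) = u"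
      using uv(1) finite_simplex[OF T] by (auto simp: convex_hull_finite)
    obtain b where b: "\<forall>x\<in>T. 0 \<le> b x" "(\<Sum>x\<in>T. b x *\<^sub>R x) = v"
      using uv(2) finite_simplex[OF T] by (auto simp: convex_hull_finite)
    show ?thesis
      unfolding a(2)[symmetric] b(2)[symmetric] inner.sum_left inner.sum_right inner.scaleR_left inner.scaleR_right
      using a(1) b(1) simplex_acute[OF T] by (auto intro!: sum_nonneg mult_nonneg_nonneg)
  qed
  obtain w where "w \<in> T - {0}" using vertices_nonempty[OF T] by blast
  then have w: "w \<in> convex hull T - {0}" by (simp add: hull_inc)
  have ne: "Q \<noteq> {}" using w by (auto simp: Q_def)
  have Q0: "0 \<le> q" if "q \<in> Q" for q using that acute by (auto simp: Q_def)
  have Q1: "q \<le> 1" if "q \<in> Q" for q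
    using that innerM_le_normM normM_pos by (auto simp: Q_def divide_le_eq_1 less_imp_le)
  have bdd: "bdd_below Q" using Q0 by (rule bdd_belowI)
  have "0 \<le> Inf Q" using ne Q0 by (rule cInf_greatest)
  moreover have "Inf Q \<le> 1" using ne bdd Q1 by (meson cInf_lower ex_in_conv order_trans)
  ultimately have cos: "cos (thetaM M T) = Inf Q" by (simp add: thetaM_def Q_def)
  show "0 \<le> cos (thetaM M T)" unfolding cos by fact
  show "cos (thetaM M T) * normM M u * normM M v \<le> innerM M u v"
    if "u \<in> convex hull T" "v \<in> convex hull T" for u v
  proof (cases "u = 0 \<or> v = 0")
    case False
    then have "cos (thetaM M T) \<le> innerM M u v / (normM M u * normM M v)"
      unfolding cos using that bdd by (intro cInf_lower) (auto simp: Q_def)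
    moreover have "0 < normM M u * normM M v" using False by (simp add: normM_pos)
    ultimately show ?thesis by (simp add: pos_le_divide_eq mult.assoc)
  qed (auto simp: inner.zero_left inner.zero_right)
qed

text \<open>The angle inequality is homogeneous in each argument, and a nonnegative combination of
  vertices is a nonnegative multiple of a point of the simplex.\<close>

lemma cone_innerM_ge:
  assumes T: "T \<in> \<T>" and a: "\<And>w. w \<in> T - {0} \<Longrightarrow> 0 \<le> a w" and b: "\<And>w. w \<in> T - {0} \<Longrightarrow> 0 \<le> b w"
  shows "cos (thetaM M T) * normM M (\<Sum>w\<in>T - {0}. a w *\<^sub>R w) * normM M (\<Sum>w\<in>T - {0}. b w *\<^sub>R w) \<le>
    innerM M (\<Sum>w\<in>T - {0}. a w *\<^sub>R w) (\<Sum>w\<in>T - {0}. b w *\<^sub>R w)"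
proof -
  have cone: "\<exists>r\<ge>0. \<exists>u\<in>convex hull T. (\<Sum>w\<in>T - {0}. a w *\<^sub>R w) = r *\<^sub>R u"
    if "\<And>w. w \<in> T - {0} \<Longrightarrow> 0 \<le> a w" for a
  proof (cases "sum a (T - {0}) = 0")
    case True
    then have "\<forall>w\<in>T - {0}. a w = 0"
      using that finite_simplex[OF T] by (subst (asm) sum_nonneg_eq_0_iff) auto
    then have "(\<Sum>w\<in>T - {0}. a w *\<^sub>R w) = 0 *\<^sub>R 0" by simp
    then show ?thesis using hull_inc[OF zero_in_simplex[OF T], of convex] by blast
  next
    case False
    define r where "r = sum a (T - {0})"
    have r: "0 < r" using False that unfolding r_def by (metis less_le sum_nonneg)
    have "(\<Sum>w\<in>T - {0}. (a w / r) *\<^sub>R w) \<in> convex hull T"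
    proof (rule convex_sum)
      show "(\<Sum>w\<in>T - {0}. a w / r) = 1" using r by (simp add: r_def flip: sum_divide_distrib)
    qed (use r that finite_simplex[OF T] in \<open>auto intro: hull_inc\<close>)
    moreover have "(\<Sum>w\<in>T - {0}. a w *\<^sub>R w) = r *\<^sub>R (\<Sum>w\<in>T - {0}. (a w / r) *\<^sub>R w)"
      using r by (simp add: scaleR_sum_right)
    ultimately show ?thesis using r by (meson less_imp_le)
  qed
  obtain r u where u: "0 \<le> r" "u \<in> convex hull T" "(\<Sum>w\<in>T - {0}. a w *\<^sub>R w) = r *\<^sub>R u"
    using cone[of a, OF a] by auto
  obtain s v where v: "0 \<le> s" "v \<in> convex hull T" "(\<Sum>w\<in>T - {0}. b w *\<^sub>R w) = s *\<^sub>R v"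
    using cone[of b, OF b] by auto
  have "r * s * (cos (thetaM M T) * normM M u * normM M v) \<le> r * s * innerM M u v"
    using u(1) v(1) innerM_ge_cos_thetaM[OF T u(2) v(2)] by (intro mult_left_mono) auto
  then show ?thesis
    unfolding u(3) v(3) using u(1) v(1)
    by (simp add: normM_scaleR inner.scaleR_left inner.scaleR_right mult_ac)
qed

text \<open>The coordinates are nonnegative because -z lies in the cone over the simplex, and
  integral because the simplex is unimodular.\<close>

lemma lattice_cone_coordinates:
  assumes T: "T \<in> \<T>" and z: "z \<in> lattice" and "0 \<le> r" "x \<in> convex hull T" "- z = r *\<^sub>R x"
  obtains n :: "real^'n \<Rightarrow> nat" where "- z = (\<Sum>v\<in>T - {0}. real (n v) *\<^sub>R v)"
proof -
  obtain u where u: "\<forall>v\<in>T. 0 \<le> u v" "(\<Sum>v\<in>T. u v *\<^sub>R v) = x"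
    using assms(4) finite_simplex[OF T] by (auto simp: convex_hull_finite)
  define c where "c v = r * u v" for v
  have c: "0 \<le> c v" if "v \<in> T" for v using u(1) \<open>0 \<le> r\<close> that by (simp add: c_def)
  have "(\<Sum>v\<in>T - {0}. c v *\<^sub>R v) = (\<Sum>v\<in>T. c v *\<^sub>R v)"
    using finite_simplex[OF T] by (intro sum.mono_neutral_left) auto
  also have "\<dots> = - z" by (simp add: c_def assms(5) u(2)[symmetric] scaleR_sum_right)
  finally have zc: "(\<Sum>v\<in>T - {0}. c v *\<^sub>R v) = - z" .
  have "c v \<in> \<int>" if "v \<in> T - {0}" for v
  proof (rule unimodular_coordinates_Ints[of "T - {0}"])
    show "measure lebesgue (convex hull insert 0 (T - {0})) = 1 / fact CARD('n)"
      using simplex_volume[OF T] zero_in_simplex[OF T] by (simp add: insert_absorb)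
    show "(\<Sum>v\<in>T - {0}. c v *\<^sub>R v) \<in> lattice" using z by (simp add: zc lattice_def)
  qed (use that finite_simplex[OF T] card_vertices[OF T] simplex_lattice[OF T] in auto)
  then have "real (nat \<lfloor>c v\<rfloor>) = c v" if "v \<in> T - {0}" for v
    using that c[of v] by (metis DiffD1 Ints_cases floor_of_int of_int_0_le_iff of_nat_nat)
  then have "- z = (\<Sum>v\<in>T - {0}. real (nat \<lfloor>c v\<rfloor>) *\<^sub>R v)" unfolding zc[symmetric] by (intro sum.cong) auto
  then show ?thesis by (rule that)
qed

text \<open>The mesh covers a ball around the origin, so a small positive multiple of any z lies in
  a simplex.\<close>

lemma ex_cone:
  obtains T r x where "T \<in> \<T>" "0 \<le> r" "x \<in> convex hull T" "z = r *\<^sub>R (x :: real^'n)"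
proof -
  obtain e where e: "0 < e" "ball 0 e \<subseteq> (\<Union>T\<in>\<T>. convex hull T)"
    using zero_interior by (meson mem_interior)
  define k where "k = e / (2 * (norm z + 1))"
  have "0 < norm z + 1" using norm_ge_zero[of z] by linarith
  then have k: "0 < k" using e(1) by (simp add: k_def)
  have "norm (k *\<^sub>R z) < e"
    using \<open>0 < norm z + 1\<close> e(1) k unfolding k_def by (simp add: field_simps) (smt (verit) mult_nonneg_nonneg norm_ge_zero)
  then have "k *\<^sub>R z \<in> ball 0 e" by simp
  then obtain T where "T \<in> \<T>" "k *\<^sub>R z \<in> convex hull T" using e(2) by blast
  then show ?thesis using k by (intro that[of T "1 / k" "k *\<^sub>R z"]) auto
qed

text \<open>Induction on \<open>\<Sum> n v\<close> with the weights \<open>n v / \<Sum> n v\<close>, that is, deleting a uniformly chosen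
  step from the multiset of steps. The harmonic numbers enter because \<open>harm k - harm (k - 1) = 1 / k\<close>
  makes the potential drop, averaged over these weights, absorb the error of a single step.\<close>

lemma fixed_point_bound:
  fixes n :: "real^'n \<Rightarrow> nat"
  assumes W0: "W 0 = 0" and W: "\<And>z. z \<in> lattice - {0} \<Longrightarrow> W z \<le> HopfLax M \<T> W z"
    and T: "T \<in> \<T>"
  defines "s \<equiv> (sin (thetaM M T))\<^sup>2"
  shows "W (- (\<Sum>v\<in>T - {0}. real (n v) *\<^sub>R v)) \<le>
    ennreal (normM M (\<Sum>v\<in>T - {0}. real (n v) *\<^sub>R v) + s * (\<Sum>v\<in>T - {0}. normM M v * harm (n v)))"
proof -
  define V where "V = T - {0}"
  define c where "c = cos (thetaM M T)"
  have s: "s = 1 - c\<^sup>2" by (simp add: s_def c_def sin_squared_eq)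
  have s0: "0 \<le> s" by (simp add: s_def)
  have c0: "0 \<le> c" "c \<le> 1" using cos_thetaM_nonneg[OF T] by (auto simp: c_def)
  have fin: "finite V" using finite_simplex[OF T] by (simp add: V_def)
  have "W (- (\<Sum>v\<in>V. real (n v) *\<^sub>R v)) \<le>
    ennreal (normM M (\<Sum>v\<in>V. real (n v) *\<^sub>R v) + s * (\<Sum>v\<in>V. normM M v * harm (n v)))"
  proof (induction "sum n V" arbitrary: n)
    case 0
    then have "\<forall>v\<in>V. n v = 0" using fin by simp
    then have "(\<Sum>v\<in>V. real (n v) *\<^sub>R v) = 0" by simp
    then show ?case using W0 by simp
  next
    case (Suc N)
    define x where "x = (\<Sum>v\<in>V. real (n v) *\<^sub>R v)"
    define X where "X = normM M x"
    define U where "U = (\<Sum>v\<in>V. normM M v * harm (n v))"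
    define \<alpha> where "\<alpha> v = real (n v) / real (Suc N)" for v
    have sumn: "(\<Sum>v\<in>V. real (n v)) = real (Suc N)" using Suc.hyps(2) by (simp flip: of_nat_sum)
    have w: "weights T \<alpha>"
      using sumn by (simp add: weights_def \<alpha>_def flip: V_def sum_divide_distrib)
    have "\<exists>v\<in>V. n v \<noteq> 0" using Suc.hyps(2) by (metis nat.distinct(1) sum.neutral)
    then obtain v1 where v1: "v1 \<in> V" "n v1 \<noteq> 0" by blast
    have "real (n v1) * normM M v1 \<le> X"
      unfolding X_def x_def V_def using v1 T by (intro vertex_coeff_le_normM) (auto simp: V_def)
    moreover have "0 < real (n v1) * normM M v1" using v1 by (auto simp: V_def normM_pos)
    ultimately have X: "0 < X" by linarith
    then have "x \<noteq> 0" by (auto simp: X_def)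
    have "x \<in> lattice"
      using simplex_lattice[OF T] unfolding x_def V_def lattice_def by (auto intro!: Ints_sum Ints_mult)
    then have zl: "- x \<in> lattice - {0}" using \<open>x \<noteq> 0\<close> by (simp add: lattice_def)
    \<comment> \<open>The norm of x - v in the induction hypothesis is traded for its linearization
      along x; the drop \<open>s * normM M v / n v\<close> of the potential pays for the difference.
      The resulting bound is affine in v, so its average is explicit. Nonnegativity is recorded to
      move the sum inside \<open>ennreal\<close>.\<close>
    have upd: "ennreal (\<alpha> v) * W (- x + v) \<le> ennreal (\<alpha> v * (innerM M (x - v) x / X + s * U))" (is ?A)
      and upd0: "0 \<le> \<alpha> v * (innerM M (x - v) x / X + s * U)" (is ?B)
      if v: "v \<in> V" for v
    proof -
      show ?A ?B
      proof (atomize (full), cases "n v = 0")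
        \<comment> \<open>The value at -x + v may be infinite here, but its weight is 0 and 0 *
          infinity = 0.\<close>
        case True
        then show "?A \<and> ?B" by (simp add: \<alpha>_def)
      next
        case False
        then have nv: "1 \<le> n v" by simp
        define n' where "n' = n(v := n v - 1)"
        define y where "y = (\<Sum>w\<in>V. real (n' w) *\<^sub>R w)"
        have split: "sum g V = g v + sum g (V - {v})" for g :: "real^'n \<Rightarrow> 'z::comm_monoid_add"
          using fin v by (rule sum.remove)
        have xy: "x = v + y"
        proof -
          have "(\<Sum>w\<in>V - {v}. real (n' w) *\<^sub>R w) = (\<Sum>w\<in>V - {v}. real (n w) *\<^sub>R w)"
            by (intro sum.cong) (auto simp: n'_def)
          then show ?thesis using nv by (simp add: x_def y_def split n'_def of_nat_diff algebra_simps)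
        qed
        have "sum n' (V - {v}) = sum n (V - {v})" by (intro sum.cong) (auto simp: n'_def)
        then have "N = sum n' V" using Suc.hyps(2) nv by (simp add: split n'_def)
        from Suc.hyps(1)[OF this]
        have IH: "W (- y) \<le> ennreal (normM M y + s * (\<Sum>v\<in>V. normM M v * harm (n' v)))"
          unfolding y_def .
        have U': "(\<Sum>v\<in>V. normM M v * harm (n' v)) = U - normM M v / real (n v)"
        proof -
          have "(\<Sum>w\<in>V - {v}. normM M w * harm (n' w)) = (\<Sum>w\<in>V - {v}. normM M w * harm (n w))"
            by (intro sum.cong) (auto simp: n'_def)
          moreover have "harm (n v) = harm (n v - 1) + inverse (real (n v))"
            using nv harm_Suc[of "n v - 1", where 'a = real] by simp
          ultimately show ?thesis by (simp add: U_def split n'_def field_simps)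
        qed
        have g: "(real (n v) - 1) * (normM M v)\<^sup>2 \<le> innerM M y v"
          using sum_coeff_le_innerM[of V "\<lambda>w. real (n' w)" v] fin v simplex_acute[OF T] nv
          by (auto simp: y_def n'_def V_def of_nat_diff)
        have vsum: "v = (\<Sum>w\<in>V. (if w = v then 1 else 0) *\<^sub>R w)"
          using fin v by (simp add: if_distrib[of "\<lambda>c. c *\<^sub>R _"] cong: if_cong)
        have cv: "c * X * normM M v \<le> innerM M x v"
          using cone_innerM_ge[OF T, of "\<lambda>w. real (n w)" "\<lambda>w. if w = v then 1 else 0"]
          by (simp flip: V_def vsum x_def c_def add: X_def)
        have cy: "c * X * normM M y \<le> innerM M x y"
          using cone_innerM_ge[OF T, of "\<lambda>w. real (n w)" "\<lambda>w. real (n' w)"]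
          by (simp flip: V_def y_def x_def c_def add: X_def)
        have inner: "innerM M x v = innerM M y v + (normM M v)\<^sup>2" "innerM M x y = (normM M y)\<^sup>2 + innerM M y v"
          "innerM M y x = (normM M y)\<^sup>2 + innerM M y v"
          by (simp_all add: xy inner.add_left inner.add_right normM_square innerM_commute)
        have "real (n v) * (normM M y - ((normM M y)\<^sup>2 + innerM M y v) / X) \<le> (1 - c\<^sup>2) * normM M v"
        proof (rule cone_step_estimate)
          show "X\<^sup>2 = (normM M y)\<^sup>2 + 2 * innerM M y v + (normM M v)\<^sup>2"
            using normM_add_square[of y v] by (simp add: X_def xy add.commute)
          show "0 < normM M v" using v by (auto simp: V_def normM_pos)
        qed (use X c0 nv g innerM_le_normM cv cy inner in auto)
        then have "normM M y - innerM M y x / X \<le> s * normM M v / real (n v)"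
          using nv by (simp add: s inner field_simps)
        then have le: "normM M y + s * (\<Sum>v\<in>V. normM M v * harm (n' v)) \<le> innerM M y x / X + s * U"
          unfolding U' by (simp add: algebra_simps)
        moreover have "0 \<le> normM M y + s * (\<Sum>v\<in>V. normM M v * harm (n' v))"
          using s0 by (intro add_nonneg_nonneg mult_nonneg_nonneg sum_nonneg) (auto simp: harm_nonneg)
        ultimately have nonneg: "0 \<le> innerM M y x / X + s * U" by linarith
        have "- x + v = - y" "x - v = y" by (simp_all add: xy)
        moreover have "W (- y) \<le> ennreal (innerM M y x / X + s * U)"
          using IH le by (meson ennreal_leI order_trans)
        moreover have "0 \<le> \<alpha> v" by (simp add: \<alpha>_def)
        ultimately show "?A \<and> ?B"
          using nonneg by (simp add: ennreal_mult mult_left_mono)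
      qed
    qed
    \<comment> \<open>The update cost is thus \<open>X / Suc N\<close>, and it cancels the average
      loss of the linear term in the computation below.\<close>
    have "(\<Sum>v\<in>V. \<alpha> v *\<^sub>R v) = (1 / real (Suc N)) *\<^sub>R x"
      by (simp add: x_def \<alpha>_def scaleR_sum_right)
    then have norm_eq: "normM M (\<Sum>v\<in>V. \<alpha> v *\<^sub>R v) = X / real (Suc N)"
      by (simp add: normM_scaleR X_def)
    have "W (- x) \<le> ennreal (normM M (\<Sum>v\<in>V. \<alpha> v *\<^sub>R v)) + (\<Sum>v\<in>V. ennreal (\<alpha> v) * W (- x + v))"
      using W[OF zl] HopfLax_le[OF T w] unfolding V_def by (meson order_trans)
    also have "\<dots> \<le> ennreal (X / real (Suc N)) + (\<Sum>v\<in>V. ennreal (\<alpha> v * (innerM M (x - v) x / X + s * U)))"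
      unfolding norm_eq using upd by (intro add_left_mono sum_mono)
    also have "\<dots> = ennreal (X / real (Suc N) + (\<Sum>v\<in>V. \<alpha> v * (innerM M (x - v) x / X + s * U)))"
      using upd0 X by (simp add: sum_ennreal ennreal_plus sum_nonneg)
    also have "(\<Sum>v\<in>V. \<alpha> v * (innerM M (x - v) x / X + s * U)) =
        (innerM M x x / X + s * U) * sum \<alpha> V - innerM M (\<Sum>v\<in>V. \<alpha> v *\<^sub>R v) x / X"
      by (simp add: inner.diff_left inner.sum_left inner.scaleR_left sum_subtractf sum.distrib
          sum_distrib_left sum_distrib_right sum_divide_distrib diff_divide_distrib algebra_simps)
    also have "\<dots> = X - X / real (Suc N) + s * U"
      unfolding \<open>(\<Sum>v\<in>V. \<alpha> v *\<^sub>R v) = _\<close> inner.scaleR_left normM_square[symmetric]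
      using w X by (simp add: weights_def V_def X_def[symmetric] power2_eq_square)
    finally show ?case by (simp add: x_def X_def U_def)
  qed
  then show ?thesis by (simp add: V_def)
qed

text \<open>Each of the d nonzero vertices contributes at most |v| (1 + ln (|x| / |v|)), and
  \<open>lnplus_scaled_mono\<close> replaces |v| by \<open>r\<close>. This is the origin of the
  factor d.\<close>

lemma harmonic_error_le:
  fixes n :: "real^'n \<Rightarrow> nat"
  assumes T: "T \<in> \<T>" and r: "\<And>v. v \<in> T \<Longrightarrow> normM M v \<le> r" and "0 \<le> r"
  defines "x \<equiv> (\<Sum>v\<in>T - {0}. real (n v) *\<^sub>R v)"
  shows "(\<Sum>v\<in>T - {0}. normM M v * harm (n v)) \<le> real CARD('n) * r * (1 + lnplus (normM M x / r))"
proof -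
  have "normM M v * harm (n v) \<le> r * (1 + lnplus (normM M x / r))" if v: "v \<in> T - {0}" for v
  proof (cases "n v = 0")
    case True
    then show ?thesis using \<open>0 \<le> r\<close> by (simp add: harm_def lnplus_def)
  next
    case False
    have pos: "0 < normM M v" using v by (auto simp: normM_pos)
    have nv: "real (n v) * normM M v \<le> normM M x"
      unfolding x_def using T v by (intro vertex_coeff_le_normM) auto
    have "1 * normM M v \<le> real (n v) * normM M v" using False by (intro mult_right_mono) auto
    then have vx: "normM M v \<le> normM M x" using nv by simp
    have "real (n v) \<le> normM M x / normM M v" using nv pos by (simp add: field_simps)
    then have "ln (real (n v)) \<le> ln (normM M x / normM M v)" using False by simp
    moreover have "harm (n v) \<le> 1 + ln (real (n v))" using False by (intro harm_le_ln) simp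
    ultimately have "normM M v * harm (n v) \<le> normM M v * (1 + ln (normM M x / normM M v))"
      by (intro mult_left_mono) auto
    also have "\<dots> \<le> r * (1 + lnplus (normM M x / r))"
      using pos r vx v by (intro lnplus_scaled_mono) auto
    finally show ?thesis .
  qed
  then have "(\<Sum>v\<in>T - {0}. normM M v * harm (n v)) \<le> (\<Sum>v\<in>T - {0}. r * (1 + lnplus (normM M x / r)))"
    by (rule sum_mono)
  then show ?thesis using card_vertices[OF T] by simp
qed

section \<open>Radii of simplices and mesh\<close>

lemma rM_simplex_ge:
  assumes "T \<in> \<T>" "v \<in> T"
  shows "normM M v \<le> rM_simplex M T"
proof -
  obtain r where "\<And>v. v \<in> T \<Longrightarrow> normM M v \<le> r" using vertex_norm_upper_bound assms(1) by metis
  then have "bdd_above (normM M ` (convex hull T))"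
    using normM_le_on_convex_hull[OF finite_simplex[OF assms(1)]] by (intro bdd_aboveI2) blast
  then show ?thesis unfolding rM_simplex_def using assms(2) by (intro cSup_upper) (auto intro: hull_inc)
qed

lemma rM_simplex_le_mesh: "T \<in> \<T> \<Longrightarrow> rM_simplex M T \<le> rM_mesh M \<T>"
  unfolding rM_mesh_def using finite_mesh by (intro Max_ge) auto

lemma rM_simplex_nonneg: "T \<in> \<T> \<Longrightarrow> 0 \<le> rM_simplex M T"
  using rM_simplex_ge[OF _ zero_in_simplex] by fastforce

section \<open>Fast marching, lower bound, uniqueness, existence and error bound\<close>

lemma infinite_lattice: "infinite (lattice :: (real^'n) set)"
proof
  assume fin: "finite (lattice :: (real^'n) set)"
  have "range (\<lambda>k :: nat. (\<chi> i. real k) :: real^'n) \<subseteq> lattice" by (auto simp: lattice_def)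
  moreover have "inj (\<lambda>k :: nat. (\<chi> i. real k) :: real^'n)" by (auto simp: inj_on_def vec_eq_iff)
  ultimately show False using fin finite_subset finite_imageD infinite_UNIV_nat by blast
qed

text \<open>Infinite values off the accepted set can only raise the operator, so tentative values
  are at least the true ones. Equality holds at \<open>f n\<close>: by causality the vertices of
  positive weight in its optimal update have smaller values, hence are already accepted, and the
  infinite values at the others are multiplied by 0.\<close>

lemma solution_fast_marching:
  assumes sol: "is_solution M \<T> \<delta>"
  shows "fast_marching_one_pass M \<T> \<delta>"
proof -
  have zero: "(0 :: real^'n) \<in> lattice" by (simp add: lattice_def)
  have min: "\<delta> 0 \<le> \<delta> z" if "z \<in> lattice" for z using sol that by (simp add: is_solution_def)
  obtain f :: "nat \<Rightarrow> real^'n" where f: "bij_betw f UNIV lattice" "f 0 = 0"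
    and mono: "\<And>n z. z \<in> lattice - f ` {..<n} \<Longrightarrow> \<delta> (f n) \<le> \<delta> z"
    using ex_increasing_enumeration[OF infinite_lattice finite_sublevel[OF sol] zero min] by blast
  have lower: "ennreal (\<delta> z) \<le> HopfLax M \<T> (restrict_inf \<delta> A) z" if "z \<in> lattice - {0}" for z A
  proof -
    have "ennreal (\<delta> z) = HopfLax M \<T> (\<lambda>y. ennreal (\<delta> y)) z" using sol that by (simp add: is_solution_def)
    also have "\<dots> \<le> HopfLax M \<T> (restrict_inf \<delta> A) z" by (intro HopfLax_mono) (simp add: restrict_inf_def)
    finally show ?thesis .
  qed
  have fn: "f n \<in> lattice - {0}" if "1 \<le> n" for n
  proof -
    have "inj f" "range f = lattice" using f(1) by (auto simp: bij_betw_def)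
    then have "f n \<noteq> f 0" "f n \<in> lattice" using that by (auto simp: inj_eq)
    then show ?thesis using f(2) by simp
  qed
  have upper: "HopfLax M \<T> (restrict_inf \<delta> (f ` {..<n})) (f n) \<le> ennreal (\<delta> (f n))" if n: "1 \<le> n" for n
  proof -
    obtain T \<alpha> where T: "T \<in> \<T>" and w: "weights T \<alpha>"
      and eq: "\<delta> (f n) = normM M (\<Sum>v\<in>T - {0}. \<alpha> v *\<^sub>R v) + (\<Sum>v\<in>T - {0}. \<alpha> v * \<delta> (f n + v))"
      and less: "\<And>v. v \<in> T - {0} \<Longrightarrow> 0 < \<alpha> v \<Longrightarrow> \<delta> (f n + v) < \<delta> (f n)"
      using solution_causal[OF sol fn[OF n]] by blast
    have fv: "f n + v \<in> lattice" if "v \<in> T" for v using lattice_step[OF _ T that] fn[OF n] by blast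
    have nonneg: "0 \<le> \<alpha> v * \<delta> (f n + v)" if "v \<in> T - {0}" for v
      using that fv w sol by (auto simp: weights_def is_solution_def)
    have "ennreal (\<alpha> v) * restrict_inf \<delta> (f ` {..<n}) (f n + v) = ennreal (\<alpha> v * \<delta> (f n + v))"
      if v: "v \<in> T - {0}" for v
    proof (cases "\<alpha> v = 0")
      case False
      then have pos: "0 < \<alpha> v" using w v by (auto simp: weights_def less_le)
      then have "f n + v \<in> f ` {..<n}" using mono[of "f n + v" n] less[OF v pos] fv v by fastforce
      then show ?thesis using pos fv v sol by (simp add: restrict_inf_def ennreal_mult is_solution_def)
    qed simp
    then have "(\<Sum>v\<in>T - {0}. ennreal (\<alpha> v) * restrict_inf \<delta> (f ` {..<n}) (f n + v)) =
        ennreal (\<Sum>v\<in>T - {0}. \<alpha> v * \<delta> (f n + v))"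
      using nonneg by (subst sum_ennreal[symmetric]) simp_all
    moreover have "0 \<le> (\<Sum>v\<in>T - {0}. \<alpha> v * \<delta> (f n + v))" using nonneg by (rule sum_nonneg)
    ultimately show ?thesis
      using HopfLax_le[OF T w, of "restrict_inf \<delta> (f ` {..<n})" "f n"]
      by (subst eq) (simp add: ennreal_plus)
  qed
  show ?thesis
    unfolding fast_marching_one_pass_def
  proof (intro exI[of _ f] conjI allI impI ballI f)
    fix n :: nat assume n: "1 \<le> n"
    show eq: "ennreal (\<delta> (f n)) = HopfLax M \<T> (restrict_inf \<delta> (f ` {..<n})) (f n)"
      using lower[OF fn[OF n]] upper[OF n] by (rule antisym)
    fix z assume z: "z \<in> lattice - f ` {..<n}"
    have "z \<noteq> 0" using z n f(2) by force
    have "ennreal (\<delta> (f n)) \<le> ennreal (\<delta> z)" using mono[OF z] by (rule ennreal_leI)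
    also have "\<dots> \<le> HopfLax M \<T> (restrict_inf \<delta> (f ` {..<n})) z" using z \<open>z \<noteq> 0\<close> by (intro lower) auto
    finally show "HopfLax M \<T> (restrict_inf \<delta> (f ` {..<n})) (f n) \<le> HopfLax M \<T> (restrict_inf \<delta> (f ` {..<n})) z"
      unfolding eq .
  qed
qed

text \<open>The norm is a subsolution: z is the weighted mean of the points z + v minus the weighted
  mean of the v, and the norm is convex and even.\<close>

lemma normM_le_solution:
  assumes sol: "is_solution M \<T> \<delta>" and z: "z \<in> lattice"
  shows "normM M z \<le> \<delta> z"
proof (rule subsolution_le_solution[OF sol _ _ z])
  fix z T \<alpha> assume w: "weights T \<alpha>"
  have "normM M z = normM M ((\<Sum>v\<in>T - {0}. \<alpha> v *\<^sub>R (z + v)) + (- (\<Sum>v\<in>T - {0}. \<alpha> v *\<^sub>R v)))"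
    using w by (simp add: weights_def scaleR_add_right sum.distrib flip: scaleR_sum_left)
  also have "\<dots> \<le> normM M (\<Sum>v\<in>T - {0}. \<alpha> v *\<^sub>R (z + v)) + normM M (\<Sum>v\<in>T - {0}. \<alpha> v *\<^sub>R v)"
    using normM_triangle[of "\<Sum>v\<in>T - {0}. \<alpha> v *\<^sub>R (z + v)" "- (\<Sum>v\<in>T - {0}. \<alpha> v *\<^sub>R v)"] by simp
  also have "normM M (\<Sum>v\<in>T - {0}. \<alpha> v *\<^sub>R (z + v)) \<le> (\<Sum>v\<in>T - {0}. normM M (\<alpha> v *\<^sub>R (z + v)))"
    by (rule normM_sum)
  also have "\<dots> = (\<Sum>v\<in>T - {0}. \<alpha> v * normM M (z + v))"
    using w by (intro sum.cong) (auto simp: weights_def normM_scaleR)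
  finally show "normM M z \<le> normM M (\<Sum>v\<in>T - {0}. \<alpha> v *\<^sub>R v) + (\<Sum>v\<in>T - {0}. \<alpha> v * normM M (z + v))"
    by (simp add: add.commute)
qed simp

lemma solution_unique:
  assumes "is_solution M \<T> \<delta>" "is_solution M \<T> \<delta>'" "z \<in> lattice"
  shows "\<delta> z = \<delta>' z"
proof -
  have "\<delta>1 z \<le> \<delta>2 z" if "is_solution M \<T> \<delta>1" "is_solution M \<T> \<delta>2" for \<delta>1 \<delta>2
  proof (rule subsolution_le_solution[OF that(2) _ _ assms(3)])
    show "\<delta>1 0 \<le> 0" using that(1) by (simp add: is_solution_def)
  qed (rule solution_le[OF that(1)])
  then show ?thesis using assms(1,2) by (intro antisym)
qed

lemma solution_exists: "\<exists>\<delta>. is_solution M \<T> \<delta>"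
proof -
  define F where "F W z = (if z = 0 then 0 else HopfLax M \<T> W z)" for W and z :: "real^'n"
  define G where "G = gfp F"
  have "mono F" by (intro monoI le_funI) (auto simp: F_def le_fun_def intro: HopfLax_mono)
  then have "G = F G" unfolding G_def by (rule gfp_unfold)
  then have "G z = F G z" for z by simp
  then have G0: "G 0 = 0" and G: "z \<noteq> 0 \<Longrightarrow> G z = HopfLax M \<T> G z" for z
    by (auto simp: F_def)
  have finite: "G z < top" if z: "z \<in> lattice" for z
  proof -
    obtain T r x where T: "T \<in> \<T>" "0 \<le> r" "x \<in> convex hull T" "- z = r *\<^sub>R x" using ex_cone .
    obtain n where n: "- z = (\<Sum>v\<in>T - {0}. real (n v) *\<^sub>R v)" using lattice_cone_coordinates[OF T(1) z T(2-4)] .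
    have "G (- (- z)) \<le> ennreal (normM M (- z) + (sin (thetaM M T))\<^sup>2 * (\<Sum>v\<in>T - {0}. normM M v * harm (n v)))"
      unfolding n using T(1) by (intro fixed_point_bound G0) (auto intro: eq_refl[OF G])
    also have "\<dots> < top" by simp
    finally show ?thesis by simp
  qed
  \<comment> \<open>Finiteness of \<open>G\<close> is known only on the lattice. Elsewhere the
    conversion may change values, but updates at lattice points read lattice values alone, by
    \<open>HopfLax_cong_lattice\<close>.\<close>
  define \<delta> where "\<delta> z = enn2real (G z)" for z
  have \<delta>: "ennreal (\<delta> z) = G z" if "z \<in> lattice" for z using finite[OF that] by (simp add: \<delta>_def)
  have "is_solution M \<T> \<delta>"
    unfolding is_solution_def
  proof (intro conjI ballI)
    show "\<delta> 0 = 0" using G0 by (simp add: \<delta>_def)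
    fix z :: "real^'n" assume z: "z \<in> lattice - {0}"
    then have "ennreal (\<delta> z) = HopfLax M \<T> G z" using G[of z] by (simp add: \<delta>)
    also have "\<dots> = HopfLax M \<T> (\<lambda>y. ennreal (\<delta> y)) z" using z \<delta> by (intro HopfLax_cong_lattice) auto
    finally show "ennreal (\<delta> z) = HopfLax M \<T> (\<lambda>y. ennreal (\<delta> y)) z" .
  qed (simp add: \<delta>_def)
  then show ?thesis by blast
qed

text \<open>Any \<open>r\<close> above the vertex norms is allowed, so the same bound serves for the
  radius of the simplex and, after bounding the squared sine by 1, for that of the mesh.\<close>

lemma solution_error_le:
  assumes sol: "is_solution M \<T> \<delta>" and z: "z \<in> lattice" and T: "T \<in> \<T>"
    and cone: "0 \<le> t" "x \<in> convex hull T" "- z = t *\<^sub>R x"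
    and r: "\<And>v. v \<in> T \<Longrightarrow> normM M v \<le> r" "0 \<le> r"
  shows "\<delta> z - normM M z \<le> real CARD('n) * (sin (thetaM M T))\<^sup>2 * r * (1 + lnplus (normM M z / r))"
proof -
  obtain n where n: "- z = (\<Sum>v\<in>T - {0}. real (n v) *\<^sub>R v)" using lattice_cone_coordinates[OF T z cone] .
  define E where "E = (\<Sum>v\<in>T - {0}. normM M v * harm (n v))"
  have E0: "0 \<le> E" by (auto simp: E_def harm_nonneg intro!: sum_nonneg)
  have "ennreal (\<delta> (- (- z))) \<le> ennreal (normM M (- z) + (sin (thetaM M T))\<^sup>2 * E)"
    unfolding n E_def using sol T by (intro fixed_point_bound) (auto simp: is_solution_def)
  then have "\<delta> z \<le> normM M z + (sin (thetaM M T))\<^sup>2 * E"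
    using E0 by (subst (asm) ennreal_le_iff) auto
  moreover have "E \<le> real CARD('n) * r * (1 + lnplus (normM M z / r))"
    using harmonic_error_le[OF T r, of n] by (simp add: E_def flip: n)
  then have "(sin (thetaM M T))\<^sup>2 * E \<le> (sin (thetaM M T))\<^sup>2 * (real CARD('n) * r * (1 + lnplus (normM M z / r)))"
    by (intro mult_left_mono) auto
  ultimately show ?thesis by (simp add: mult_ac)
qed

end

theorem theorem1:
  fixes M :: "real^'n^'n" and \<T> :: "(real^'n) set set"
  assumes "sym_pos_definite M" and "M_reduced_mesh M \<T>"
  shows "\<exists>\<delta>M. is_solution M \<T> \<delta>M \<and>
           (\<forall>\<delta>. is_solution M \<T> \<delta> \<longrightarrow> (\<forall>z\<in>lattice. \<delta> z = \<delta>M z)) \<and>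
           fast_marching_one_pass M \<T> \<delta>M \<and>
           (\<forall>z\<in>lattice.
              0 \<le> \<delta>M z - normM M z \<and>
              \<delta>M z - normM M z \<le> real CARD('n) * rM_mesh M \<T> *
                 (1 + lnplus (normM M z / rM_mesh M \<T>))) \<and>
           (\<forall>z\<in>lattice. \<forall>T\<in>\<T>. (\<exists>r\<ge>0. \<exists>x\<in>convex hull T. - z = r *\<^sub>R x) \<longrightarrow>
              0 \<le> \<delta>M z - normM M z \<and>
              \<delta>M z - normM M z \<le> real CARD('n) * (sin (thetaM M T))\<^sup>2 * rM_simplex M T *
                 (1 + lnplus (normM M z / rM_simplex M T)))"
proof -
  interpret reduced_mesh M \<T> using assms by unfold_locales
  obtain \<delta> where sol: "is_solution M \<T> \<delta>" using solution_exists by blast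
  have lower: "0 \<le> \<delta> z - normM M z" if "z \<in> lattice" for z
    using normM_le_solution[OF sol that] by simp
  have mesh_bound: "\<delta> z - normM M z \<le> real CARD('n) * rM_mesh M \<T> * (1 + lnplus (normM M z / rM_mesh M \<T>))"
    if z: "z \<in> lattice" for z
  proof -
    obtain T t x where T: "T \<in> \<T>" "0 \<le> t" "x \<in> convex hull T" "- z = t *\<^sub>R x" using ex_cone .
    have r: "normM M v \<le> rM_mesh M \<T>" if "v \<in> T" for v
      using rM_simplex_ge[OF T(1) that] rM_simplex_le_mesh[OF T(1)] by simp
    have r0: "0 \<le> rM_mesh M \<T>" using rM_simplex_nonneg[OF T(1)] rM_simplex_le_mesh[OF T(1)] by simp
    have "\<delta> z - normM M z \<le> (sin (thetaM M T))\<^sup>2 *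
        (real CARD('n) * rM_mesh M \<T> * (1 + lnplus (normM M z / rM_mesh M \<T>)))"
      using solution_error_le[OF sol z T r r0] by (simp add: mult_ac)
    also have "\<dots> \<le> 1 * (real CARD('n) * rM_mesh M \<T> * (1 + lnplus (normM M z / rM_mesh M \<T>)))"
      using r0 by (intro mult_right_mono) (auto simp: lnplus_def abs_square_le_1)
    finally show ?thesis by simp
  qed
  show ?thesis
  proof (intro exI[of _ \<delta>] conjI allI impI ballI)
    show "\<delta>' z = \<delta> z" if "is_solution M \<T> \<delta>'" "z \<in> lattice" for \<delta>' z
      using that sol by (intro solution_unique)
    show "\<delta> z - normM M z \<le> real CARD('n) * (sin (thetaM M T))\<^sup>2 * rM_simplex M T *
        (1 + lnplus (normM M z / rM_simplex M T))"
      if "z \<in> lattice" "T \<in> \<T>" "\<exists>r\<ge>0. \<exists>x\<in>convex hull T. - z = r *\<^sub>R x" for z T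
      using that solution_error_le[OF sol] rM_simplex_ge rM_simplex_nonneg by blast
  qed (use sol solution_fast_marching lower mesh_bound in auto)
qed

end
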